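(* Let $\epsilon\in\{-1,1\}$ be fixed. The equivalence group $G^\sim_{\mathcal K'^\epsilon}$ of the class $\mathcal K'^\epsilon$ of reduced Kolmogorov equations with time-independent drifts, $u_t=\epsilon u_{xx}+B(x)u_x$, consists of the point transformations of the form \[ \tilde t=c_1^2t+c_2,\quad\tilde x=c_1x+c_3,\quad\tilde u=c_4u+c_5,\quad\tilde B=\frac1{c_1}B, \] where $c_1,\dots,c_5$ are arbitrary constants with $c_1c_4\neq0$.
   Context: Everything is real, smooth and local. The arbitrary element of the class is the smooth function $B$ of $x$, regarded as a coordinate when working with equivalence transformations. The (usual) equivalence (pseudo)group of the class consists of the point transformations (local diffeomorphisms) in the space with coordinates $(t,x,u_{(2)},B)$, where $u_{(2)}$ denotes $u$ and its derivatives up to order two, that are projectable to the spaces of $(t,x,u)$ and of $(t,x,u_{(2)})$, are consistent with the contact structure of the second-order jet space (so their components for derivatives are obtained by standard prolongation and are not listed), and map every equation of the class to an equation of the class (with the transformed arbitrary element) for any value of the arbitrary element.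
   Formalization: The transformations' domains are taken connected and such that over every (t,x,u,B) they cover there is a jet satisfying u_t = εu_xx + Bu_x; on domains missing all equations of the class the mapping requirement would be vacuous and the claim false. *)

theory Defs
  imports "HOL-Analysis.Analysis"
begin

text \<open>
  \<open>differentiable_order k S f\<close> says that \<open>f\<close> is of class \<open>C\<^sup>k\<close> on \<open>S\<close>; it is meant for open \<open>S\<close> in a
  finite-dimensional space, where it suffices that all directional derivatives \<open>\<lambda>x. f' x v\<close> of
  the total derivative are of class \<open>C\<close> of one order less.
\<close>

primrec differentiable_order ::
  "nat \<Rightarrow> 'a::euclidean_space set \<Rightarrow> ('a \<Rightarrow> 'b::euclidean_space) \<Rightarrow> bool" where
  "differentiable_order 0 S f \<longleftrightarrow> continuous_on S f"
| "differentiable_order (Suc k) S f \<longleftrightarrow>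
     (\<exists>f'. (\<forall>x\<in>S. (f has_derivative f' x) (at x)) \<and>
           (\<forall>v. differentiable_order k S (\<lambda>x. f' x v)))"

definition smooth_on :: "'a::euclidean_space set \<Rightarrow> ('a \<Rightarrow> 'b::euclidean_space) \<Rightarrow> bool" where
  "smooth_on S f \<longleftrightarrow> (\<forall>k. differentiable_order k S f)"

definition diffeomorphism_on :: "'a::euclidean_space set \<Rightarrow> ('a \<Rightarrow> 'b::euclidean_space) \<Rightarrow> bool" where
  "diffeomorphism_on D f \<longleftrightarrow>
     open D \<and> smooth_on D f \<and> inj_on f D \<and> open (f ` D) \<and> smooth_on (f ` D) (the_inv_into D f)"

text \<open>
  Points of the second-order jet space are written
  \<open>((t, x, u), (u\<^sub>t, u\<^sub>x), (u\<^sub>t\<^sub>t, u\<^sub>t\<^sub>x, u\<^sub>x\<^sub>x))\<close>; in the extended space the value \<open>b\<close> of the arbitrary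
  element \<open>B\<close> is a further coordinate.
\<close>

type_synonym base = "real \<times> real \<times> real"
type_synonym jet2 = "base \<times> (real \<times> real) \<times> (real \<times> real \<times> real)"
type_synonym ext_jet2 = "jet2 \<times> real"

definition x_coord :: "jet2 \<Rightarrow> real" where
  "x_coord z = fst (snd (fst z))"

text \<open>The common kernel of the contact forms \<open>du - u\<^sub>t dt - u\<^sub>x dx\<close>, \<open>du\<^sub>t - u\<^sub>t\<^sub>t dt - u\<^sub>t\<^sub>x dx\<close>
  and \<open>du\<^sub>x - u\<^sub>t\<^sub>x dt - u\<^sub>x\<^sub>x dx\<close> at a point of the jet space.\<close>

fun contact_space :: "jet2 \<Rightarrow> jet2 set" where
  "contact_space ((t, x, u), (ut, ux), (utt, utx, uxx)) =
     {((dt, dx, du), (dut, dux), (dutt, dutx, duxx)) |dt dx du dut dux dutt dutx duxx.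
        du = ut * dt + ux * dx \<and>
        dut = utt * dt + utx * dx \<and>
        dux = utx * dt + uxx * dx}"

definition contact_preserving :: "ext_jet2 set \<Rightarrow> (ext_jet2 \<Rightarrow> ext_jet2) \<Rightarrow> bool" where
  "contact_preserving D \<Phi> \<longleftrightarrow>
     (\<forall>p\<in>D. \<forall>v. fst v \<in> contact_space (fst p) \<longrightarrow>
        fst (frechet_derivative \<Phi> (at p) v) \<in> contact_space (fst (\<Phi> p)))"

definition projectable :: "ext_jet2 set \<Rightarrow> (ext_jet2 \<Rightarrow> ext_jet2) \<Rightarrow> bool" where
  "projectable D \<Phi> \<longleftrightarrow>
     (\<exists>\<phi> :: base \<Rightarrow> base. \<forall>p\<in>D. fst (fst (\<Phi> p)) = \<phi> (fst (fst p))) \<and>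
     (\<exists>\<psi> :: jet2 \<Rightarrow> jet2. \<forall>p\<in>D. fst (\<Phi> p) = \<psi> (fst p))"

text \<open>Values of the arbitrary element are smooth functions \<open>B\<close> of \<open>x\<close> on an open interval \<open>I\<close>.\<close>

definition arbitrary_element :: "real set \<Rightarrow> (real \<Rightarrow> real) \<Rightarrow> bool" where
  "arbitrary_element I B \<longleftrightarrow> open I \<and> is_interval I \<and> smooth_on I B"

text \<open>The equation \<open>u\<^sub>t = \<epsilon> u\<^sub>x\<^sub>x + B(x) u\<^sub>x\<close> as a submanifold of the jet space.\<close>

definition kolmogorov_eq :: "real \<Rightarrow> real set \<Rightarrow> (real \<Rightarrow> real) \<Rightarrow> jet2 set" where
  "kolmogorov_eq \<epsilon> I B =
     {((t, x, u), (ut, ux), (utt, utx, uxx)) |t x u ut ux utt utx uxx.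
        x \<in> I \<and> ut = \<epsilon> * uxx + B x * ux}"

text \<open>The jets at which \<open>\<Phi>\<close>, with domain \<open>D\<close>, can be applied when the arbitrary element is \<open>B\<close>.\<close>

definition jet_domain :: "ext_jet2 set \<Rightarrow> real set \<Rightarrow> (real \<Rightarrow> real) \<Rightarrow> jet2 set" where
  "jet_domain D I B = {z. x_coord z \<in> I \<and> (z, B (x_coord z)) \<in> D}"

text \<open>
  The transformed arbitrary element is the function whose graph (over the whole jet domain, not
  only over the equation) is the image of the graph of \<open>B\<close>; in particular it has to be a
  function of the transformed \<open>x\<close> alone.  The equation is mapped to the equation with the
  transformed arbitrary element.
\<close>

definition maps_equation ::
  "real \<Rightarrow> ext_jet2 set \<Rightarrow> (ext_jet2 \<Rightarrow> ext_jet2) \<Rightarrow>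
   real set \<Rightarrow> (real \<Rightarrow> real) \<Rightarrow> real set \<Rightarrow> (real \<Rightarrow> real) \<Rightarrow> bool" where
  "maps_equation \<epsilon> D \<Phi> I B J B' \<longleftrightarrow>
     (let S = jet_domain D I B; \<Phi>\<^sub>B = (\<lambda>z. \<Phi> (z, B (x_coord z))) in
       (\<forall>z\<in>S. x_coord (fst (\<Phi>\<^sub>B z)) \<in> J \<and> snd (\<Phi>\<^sub>B z) = B' (x_coord (fst (\<Phi>\<^sub>B z)))) \<and>
       (fst \<circ> \<Phi>\<^sub>B) ` (S \<inter> kolmogorov_eq \<epsilon> I B) = (fst \<circ> \<Phi>\<^sub>B) ` S \<inter> kolmogorov_eq \<epsilon> J B')"

text \<open>
  Domains of the local transformations.  The last condition says that every point \<open>(t, x, u, b)\<close>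
  below \<open>D\<close> also lies below a point of \<open>D\<close> at which \<open>u\<^sub>t = \<epsilon> u\<^sub>x\<^sub>x + b u\<^sub>x\<close>.  Without such a
  condition, mapping equations to equations would be a vacuous requirement on
  domains (or on parts of domains) disjoint from all equations of the class.  The condition holds whenever
  \<open>D\<close> does not restrict the second-order derivatives, as for the natural domains of
  prolonged point transformations.
\<close>

definition admissible_domain :: "real \<Rightarrow> ext_jet2 set \<Rightarrow> bool" where
  "admissible_domain \<epsilon> D \<longleftrightarrow> open D \<and> connected D \<and> D \<noteq> {} \<and>
     (\<forall>t x u d1 d2 b. (((t, x, u), d1, d2), b) \<in> D \<longrightarrow>
        (\<exists>ut ux utt utx uxx. (((t, x, u), (ut, ux), (utt, utx, uxx)), b) \<in> D \<and>
           ut = \<epsilon> * uxx + b * ux))"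

text \<open>
  The equivalence pseudogroup.  Its elements are pairs of a domain \<open>D\<close> and a map \<open>\<Phi>\<close>; the values
  of \<open>\<Phi>\<close> outside \<open>D\<close> are irrelevant.
\<close>

definition equivalence_group :: "real \<Rightarrow> (ext_jet2 set \<times> (ext_jet2 \<Rightarrow> ext_jet2)) set" where
  "equivalence_group \<epsilon> =
     {(D, \<Phi>). admissible_domain \<epsilon> D \<and> diffeomorphism_on D \<Phi> \<and> projectable D \<Phi> \<and>
        contact_preserving D \<Phi> \<and>
        (\<forall>I B. arbitrary_element I B \<longrightarrow>
           (\<exists>J B'. arbitrary_element J B' \<and> maps_equation \<epsilon> D \<Phi> I B J B'))}"

end

theory Submission
  imports Defs
begin

text \<open>
  Write \<open>T, X, U, G\<close> for the transformed \<open>t, x, u, B\<close>. For the arbitrary elements \<open>B = const\<close> and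
  \<open>B = x + const\<close> the component \<open>G\<close> is a function of \<open>X\<close> alone, so \<open>X\<close> can only be constant along
  directions that keep \<open>x\<close>, whence \<open>X\<^sub>t = X\<^sub>u = 0\<close>. If the total derivative \<open>D\<^sub>x T\<close> were nonzero
  at a point of an equation, the contact conditions and the transformed equation would make \<open>\<Phi>\<close>
  constant along \<open>u\<^sub>t\<^sub>t\<close>; hence \<open>T\<^sub>x = T\<^sub>u = 0\<close>. Now the transformed equation is polynomial in
  \<open>u\<^sub>x, u\<^sub>x\<^sub>x\<close>: the coefficient of \<open>u\<^sub>x\<^sub>x\<close> gives \<open>T\<^sub>t = X\<^sub>x\<^sup>2\<close>, so both sides are constant, and the
  powers of \<open>u\<^sub>x\<close>, for varying values of \<open>B\<close>, give \<open>U\<^sub>t = U\<^sub>x = U\<^sub>u\<^sub>u = 0\<close>. Connectedness of the domain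
  makes the constants global.
\<close>

section \<open>Directional derivatives and smooth maps\<close>

lemma differentiable_order_cong:
  assumes "open S" "\<And>x. x \<in> S \<Longrightarrow> f x = g x" "differentiable_order k S f"
  shows "differentiable_order k S g"
proof (cases k)
  case 0
  then show ?thesis
    using assms continuous_on_cong[OF refl assms(2)] by simp
next
  case (Suc n)
  then obtain f' where "\<forall>x\<in>S. (f has_derivative f' x) (at x)"
      "\<forall>v. differentiable_order n S (\<lambda>x. f' x v)"
    using assms(3) by auto
  moreover from this have "\<forall>x\<in>S. (g has_derivative f' x) (at x)"
    using assms has_derivative_transform_within_open by blast
  ultimately show ?thesis using Suc by auto
qed

lemma differentiable_order_const: "differentiable_order k S (\<lambda>x. c)"
proof (induction k arbitrary: c)
  case (Suc k)
  show ?case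
    using Suc by (auto intro!: exI[of _ "\<lambda>x v. 0"])
qed simp

lemma differentiable_order_bounded_linear_comp:
  assumes "bounded_linear h" "differentiable_order k S f"
  shows "differentiable_order k S (\<lambda>x. h (f x))"
  using assms(2)
proof (induction k arbitrary: f)
  case 0
  then show ?case
    using bounded_linear.continuous_on[OF assms(1)] by auto
next
  case (Suc k)
  then obtain f' where f': "\<forall>x\<in>S. (f has_derivative f' x) (at x)"
      "\<forall>v. differentiable_order k S (\<lambda>x. f' x v)"
    by auto
  then have "\<forall>x\<in>S. ((\<lambda>x. h (f x)) has_derivative (\<lambda>v. h (f' x v))) (at x)"
    using bounded_linear.has_derivative[OF assms(1)] by blast
  moreover have "\<forall>v. differentiable_order k S (\<lambda>x. h (f' x v))"
    using Suc.IH f'(2) by blast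
  ultimately show ?case
    unfolding differentiable_order.simps by (intro exI[of _ "\<lambda>x v. h (f' x v)"] conjI)
qed

text \<open>The derivative of the composite in direction \<open>v\<close> is again a composite of
  the same kind, with \<open>f'\<close> taken in the fixed direction \<open>L v\<close>, so the
  induction needs no product rule.\<close>

lemma differentiable_order_affine_comp:
  fixes f :: "'b::euclidean_space \<Rightarrow> 'c::euclidean_space" and L :: "'a::euclidean_space \<Rightarrow> 'b"
  assumes L: "bounded_linear L" and "differentiable_order k S f"
  shows "differentiable_order k {y. L y + c \<in> S} (\<lambda>y. f (L y + c))"
  using assms(2)
proof (induction k arbitrary: f)
  case 0
  then have "continuous_on S f"
    by simp
  then have "continuous_on {y. L y + c \<in> S} (\<lambda>y. f (L y + c))"
    by (rule continuous_on_compose2)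
      (auto intro!: continuous_intros bounded_linear.continuous_on[OF L])
  then show ?case by simp
next
  case (Suc k)
  then obtain f' where f': "\<forall>x\<in>S. (f has_derivative f' x) (at x)"
      "\<forall>v. differentiable_order k S (\<lambda>x. f' x v)"
    by auto
  have "\<forall>y\<in>{y. L y + c \<in> S}.
      ((\<lambda>y. f (L y + c)) has_derivative (\<lambda>v. f' (L y + c) (L v))) (at y)"
    using f'(1)
    by (intro ballI has_derivative_compose[where g = f and f = "\<lambda>y. L y + c"])
      (auto intro!: derivative_eq_intros bounded_linear.has_derivative[OF L])
  moreover have "\<forall>v. differentiable_order k {y. L y + c \<in> S} (\<lambda>y. f' (L y + c) (L v))"
    using Suc.IH f'(2) by blast
  ultimately show ?case
    unfolding differentiable_order.simps
    by (intro exI[of _ "\<lambda>y v. f' (L y + c) (L v)"] conjI)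
qed

lemma smooth_on_cong:
  "open S \<Longrightarrow> (\<And>x. x \<in> S \<Longrightarrow> f x = g x) \<Longrightarrow> smooth_on S f \<Longrightarrow> smooth_on S g"
  unfolding smooth_on_def using differentiable_order_cong by blast

lemma smooth_on_affine:
  assumes "bounded_linear L"
  shows "smooth_on S (\<lambda>x. L x + c)"
  unfolding smooth_on_def
proof
  fix k
  show "differentiable_order k S (\<lambda>x. L x + c)"
  proof (cases k)
    case 0
    then show ?thesis
      using bounded_linear.continuous_on[OF assms] by (auto intro!: continuous_intros)
  next
    case (Suc n)
    have "((\<lambda>x. L x + c) has_derivative L) (at x)" for x
      by (auto intro!: derivative_eq_intros bounded_linear.has_derivative[OF assms])
    then show ?thesis
      using Suc differentiable_order_const by (auto intro!: exI[of _ "\<lambda>x. L"])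
  qed
qed

section \<open>Directional derivatives as operators on functions\<close>

definition dir_deriv :: "'a::real_normed_vector \<Rightarrow> ('a \<Rightarrow> 'b::real_normed_vector) \<Rightarrow> 'a \<Rightarrow> 'b" where
  "dir_deriv v f p = frechet_derivative f (at p) v"

lemma dir_deriv_eqI: "(f has_derivative f') (at p) \<Longrightarrow> dir_deriv v f p = f' v"
  unfolding dir_deriv_def by (drule frechet_derivative_at) simp

lemma has_derivative_dir_deriv:
  "f differentiable (at p) \<Longrightarrow> (f has_derivative (\<lambda>v. dir_deriv v f p)) (at p)"
  unfolding dir_deriv_def by (simp add: frechet_derivative_works)

lemma dir_deriv_zero: "f differentiable (at p) \<Longrightarrow> dir_deriv 0 f p = 0"
  unfolding dir_deriv_def by (rule linear_0[OF linear_frechet_derivative])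

lemma dir_deriv_const [simp]: "dir_deriv v (\<lambda>x. c) p = 0"
  by (rule dir_deriv_eqI[OF has_derivative_const])

lemma dir_deriv_cong:
  assumes "open S" "p \<in> S" "\<And>x. x \<in> S \<Longrightarrow> f x = g x" "f differentiable (at p)"
  shows "dir_deriv v f p = dir_deriv v g p"
  using dir_deriv_eqI[OF has_derivative_transform_within_open
      [OF has_derivative_dir_deriv[OF assms(4)] assms(1-3)]] by simp

lemma smooth_on_imp_differentiable:
  assumes "smooth_on S f" "p \<in> S"
  shows "f differentiable (at p)"
proof -
  have "differentiable_order (Suc 0) S f"
    using assms(1) unfolding smooth_on_def by blast
  then obtain f' where "\<forall>x\<in>S. (f has_derivative f' x) (at x)"
    unfolding differentiable_order.simps by blast
  then show ?thesis
    using assms(2) differentiableI by blast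
qed

text \<open>On \<open>S\<close> any family of derivatives witnessing the definition coincides with
  \<open>frechet_derivative\<close>, and openness of \<open>S\<close> lets one replace the
  other.\<close>

lemma smooth_on_dir_deriv:
  assumes "open S" "smooth_on S f"
  shows "smooth_on S (dir_deriv v f)"
  unfolding smooth_on_def
proof
  fix k
  have "differentiable_order (Suc k) S f"
    using assms(2) unfolding smooth_on_def by blast
  then obtain f' where f': "\<forall>x\<in>S. (f has_derivative f' x) (at x)"
      "\<forall>v. differentiable_order k S (\<lambda>x. f' x v)"
    by auto
  show "differentiable_order k S (dir_deriv v f)"
  proof (rule differentiable_order_cong[OF assms(1) _ f'(2)[THEN spec, of v]])
    fix x assume "x \<in> S"
    with f'(1) show "f' x v = dir_deriv v f x"
      by (intro dir_deriv_eqI[symmetric]) blast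
  qed
qed

lemma dir_deriv_mult:
  fixes f g :: "'a::real_normed_vector \<Rightarrow> real"
  assumes "f differentiable (at p)" "g differentiable (at p)"
  shows "dir_deriv v (\<lambda>x. f x * g x) p = f p * dir_deriv v g p + dir_deriv v f p * g p"
  using has_derivative_mult[OF assms[THEN has_derivative_dir_deriv]] by (rule dir_deriv_eqI)

lemma dir_deriv_add:
  assumes "f differentiable (at p)" "g differentiable (at p)"
  shows "dir_deriv v (\<lambda>x. f x + g x) p = dir_deriv v f p + dir_deriv v g p"
  using has_derivative_add[OF assms[THEN has_derivative_dir_deriv]] by (rule dir_deriv_eqI)

lemma has_vector_derivative_along_line:
  assumes "f differentiable (at (p + s *\<^sub>R v))"
  shows "((\<lambda>s. f (p + s *\<^sub>R v)) has_vector_derivative dir_deriv v f (p + s *\<^sub>R v)) (at s within A)"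
proof -
  have "((\<lambda>s. p + s *\<^sub>R v) has_derivative (\<lambda>h. h *\<^sub>R v)) (at s within A)"
    by (auto intro!: derivative_eq_intros)
  from has_derivative_compose[OF this has_derivative_dir_deriv[OF assms]]
  have "((\<lambda>s. f (p + s *\<^sub>R v)) has_derivative (\<lambda>h. dir_deriv (h *\<^sub>R v) f (p + s *\<^sub>R v)))
          (at s within A)" .
  moreover have "dir_deriv (h *\<^sub>R v) f q = h *\<^sub>R dir_deriv v f q" if "f differentiable (at q)" for h q
    using linear_frechet_derivative[OF that] unfolding dir_deriv_def by (rule linear_cmul)
  ultimately show ?thesis
    unfolding has_vector_derivative_def by (simp only: assms)
qed

text \<open>Convexity keeps the segment between the two points in \<open>C\<close>, and
  \<open>f\<close> has zero derivative along it.\<close>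

lemma constant_along_direction:
  assumes "convex C" "\<And>q. q \<in> C \<Longrightarrow> f differentiable (at q)" "\<And>q. q \<in> C \<Longrightarrow> dir_deriv w f q = 0"
    and "q \<in> C" "q + s *\<^sub>R w \<in> C"
  shows "f (q + s *\<^sub>R w) = f q"
proof -
  \<comment> \<open>The segment is parametrised over the unit interval, which treats both signs of
    \<open>s\<close> at once.\<close>
  have in_C: "q + r *\<^sub>R s *\<^sub>R w \<in> C" if "r \<in> {0..1}" for r
  proof -
    have "q + r *\<^sub>R s *\<^sub>R w = (1 - r) *\<^sub>R q + r *\<^sub>R (q + s *\<^sub>R w)"
      by (simp add: algebra_simps)
    then show ?thesis
      using that assms(1,4,5) by (auto simp: convex_alt)
  qed
  have 0: "dir_deriv (s *\<^sub>R w) f q = 0" if "q \<in> C" for q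
    using assms(3)[OF that] linear_cmul[OF linear_frechet_derivative[OF assms(2)[OF that]]]
    unfolding dir_deriv_def by simp
  have "((\<lambda>r. f (q + r *\<^sub>R s *\<^sub>R w)) has_derivative (\<lambda>h. 0)) (at r within {0..1})"
    if "r \<in> {0..1}" for r
    using has_vector_derivative_along_line[OF assms(2)[OF in_C[OF that]], of "{0..1}"]
      0[OF in_C[OF that]]
    unfolding has_vector_derivative_def by simp
  then obtain c where "\<forall>r\<in>{0..1}. f (q + r *\<^sub>R s *\<^sub>R w) = c"
    using has_derivative_zero_constant[of "{0..1::real}" "\<lambda>r. f (q + r *\<^sub>R s *\<^sub>R w)"] by auto
  from this[THEN bspec, of 0] this[THEN bspec, of 1] show ?thesis
    by simp
qed

text \<open>On the open set of points whose translate by \<open>s *\<^sub>R w\<close> also lies in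
  \<open>C\<close>, \<open>f\<close> equals its translate, and equal functions have equal
  derivatives.\<close>

lemma dir_deriv_constant_along_direction:
  assumes "convex C" "open C" "\<And>q. q \<in> C \<Longrightarrow> f differentiable (at q)"
    and "\<And>q. q \<in> C \<Longrightarrow> dir_deriv w f q = 0" "q \<in> C" "q + s *\<^sub>R w \<in> C"
  shows "dir_deriv v f (q + s *\<^sub>R w) = dir_deriv v f q"
proof -
  define A where "A = C \<inter> {y. y + s *\<^sub>R w \<in> C}"
  have "open {y. y + s *\<^sub>R w \<in> C}"
    using open_vimage[OF assms(2), of "\<lambda>y. y + s *\<^sub>R w"] by (simp add: vimage_def continuous_intros)
  then have A: "open A" "q \<in> A"
    using assms unfolding A_def by auto
  have "((\<lambda>y. f (y + s *\<^sub>R w)) has_derivative (\<lambda>v. dir_deriv v f (q + s *\<^sub>R w))) (at q)"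
    using has_derivative_dir_deriv[OF assms(3)[OF assms(6)]]
    by (intro has_derivative_compose[where g = f and f = "\<lambda>y. y + s *\<^sub>R w"])
      (auto intro!: derivative_eq_intros)
  then have "(f has_derivative (\<lambda>v. dir_deriv v f (q + s *\<^sub>R w))) (at q)"
    by (rule has_derivative_transform_within_open[OF _ A])
      (use constant_along_direction[of C f w] assms in \<open>auto simp: A_def\<close>)
  then show ?thesis
    using dir_deriv_eqI[of f _ q v] by simp
qed

text \<open>The instance \<open>f\<^sub>w = 0\<close> of the symmetry of second derivatives.\<close>

lemma dir_deriv_swap_zero:
  assumes "open S" "smooth_on S f" "\<And>q. q \<in> S \<Longrightarrow> dir_deriv w f q = 0" "p \<in> S"
  shows "dir_deriv w (dir_deriv v f) p = 0"
proof -
  obtain r where r: "r > 0" "ball p r \<subseteq> S"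
    using assms openE by blast
  define A where "A = (\<lambda>s. p + s *\<^sub>R w) -` ball p r"
  have A: "open A" "0 \<in> A"
    unfolding A_def using r by (auto intro!: open_vimage continuous_intros)
  \<comment> \<open>Moving along \<open>w\<close> does not change the \<open>v\<close>-derivative,
    so the \<open>w\<close>-derivative of \<open>dir_deriv v f\<close> is that of a
    constant.\<close>
  have *: "dir_deriv v f p = dir_deriv v f (p + s *\<^sub>R w)" if "s \<in> A" for s
    by (rule dir_deriv_constant_along_direction[symmetric, of "ball p r"])
      (use r that assms smooth_on_imp_differentiable[OF assms(2)] in \<open>auto simp: A_def\<close>)
  have "dir_deriv v f differentiable (at (p + 0 *\<^sub>R w))"
    using smooth_on_imp_differentiable[OF smooth_on_dir_deriv] assms by auto
  from has_vector_derivative_along_line[OF this, of UNIV]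
  have "((\<lambda>s. dir_deriv v f (p + s *\<^sub>R w)) has_vector_derivative dir_deriv w (dir_deriv v f) p) (at 0)"
    by simp
  moreover have "((\<lambda>s. dir_deriv v f (p + s *\<^sub>R w)) has_vector_derivative 0) (at 0)"
    by (rule has_vector_derivative_transform_within_open[OF has_vector_derivative_const A])
      (use * in auto)
  ultimately show ?thesis
    by (rule vector_derivative_unique_at)
qed

lemma constant_on_connected_if_dir_deriv_zero:
  assumes "open S" "connected S" "smooth_on S f" "\<And>p v. p \<in> S \<Longrightarrow> dir_deriv v f p = 0"
    and "p \<in> S" "q \<in> S"
  shows "f p = f q"
proof (rule has_derivative_zero_unique_connected[OF assms(1,2) _ assms(5,6)])
  fix y assume "y \<in> S"
  then show "(f has_derivative (\<lambda>v. 0)) (at y)"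
    using has_derivative_dir_deriv[OF smooth_on_imp_differentiable[OF assms(3)], of y] assms(4)
    by simp
qed

text \<open>A quadratic polynomial with three distinct zeros vanishes. The variable is written
  \<open>x + s\<close> because the zeros are found around a given value of a jet coordinate.\<close>

lemma quadratic_zero_coeffs:
  fixes a b c x r :: real
  assumes "r > 0" and zero: "\<And>s. \<bar>s\<bar> < r \<Longrightarrow> a + b * (x + s) + c * (x + s)\<^sup>2 = 0"
  shows "a = 0" "b = 0" "c = 0"
proof -
  define s where "s = r / 2"
  have s: "s \<noteq> 0" "\<bar>0\<bar> < r" "\<bar>s\<bar> < r" "\<bar>- s\<bar> < r"
    using assms(1) unfolding s_def by auto
  note eqs = zero[OF s(2)] zero[OF s(3)] zero[OF s(4)]
  \<comment> \<open>The second difference over the three sample points eliminates \<open>a\<close>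
    and \<open>b\<close>.\<close>
  have "2 * c * s\<^sup>2 = 0"
    using eqs by algebra
  then show c: "c = 0"
    using s(1) by simp
  have "b * s = 0"
    using eqs(1,2) c by algebra
  then show b: "b = 0"
    using s(1) by simp
  show "a = 0"
    using eqs(1) b c by simp
qed

section \<open>Components of an equivalence transformation\<close>

abbreviation jet :: "real \<Rightarrow> real \<Rightarrow> real \<Rightarrow> real \<Rightarrow> real \<Rightarrow> real \<Rightarrow> real \<Rightarrow> real \<Rightarrow> real \<Rightarrow> ext_jet2" where
  "jet t x u ut ux utt utx uxx b \<equiv> (((t, x, u), (ut, ux), (utt, utx, uxx)), b)"

abbreviation "e_t \<equiv> jet 1 0 0 0 0 0 0 0 0"
abbreviation "e_x \<equiv> jet 0 1 0 0 0 0 0 0 0"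
abbreviation "e_u \<equiv> jet 0 0 1 0 0 0 0 0 0"
abbreviation "e_ut \<equiv> jet 0 0 0 1 0 0 0 0 0"
abbreviation "e_ux \<equiv> jet 0 0 0 0 1 0 0 0 0"
abbreviation "e_utt \<equiv> jet 0 0 0 0 0 1 0 0 0"
abbreviation "e_utx \<equiv> jet 0 0 0 0 0 0 1 0 0"
abbreviation "e_uxx \<equiv> jet 0 0 0 0 0 0 0 1 0"
abbreviation "e_b \<equiv> jet 0 0 0 0 0 0 0 0 1"

lemma kolmogorov_eq_iff:
  "((t, x, u), (ut, ux), (utt, utx, uxx)) \<in> kolmogorov_eq \<epsilon> I B \<longleftrightarrow>
    x \<in> I \<and> ut = \<epsilon> * uxx + B x * ux"
  unfolding kolmogorov_eq_def by blast

lemma contact_space_iff: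
  "((dt, dx, du), (dut, dux), (dutt, dutx, duxx)) \<in> contact_space ((t, x, u), (ut, ux), (utt, utx, uxx)) \<longleftrightarrow>
    du = ut * dt + ux * dx \<and> dut = utt * dt + utx * dx \<and> dux = utx * dt + uxx * dx"
  unfolding contact_space.simps by blast

lemma dir_deriv_jet:
  fixes f :: "ext_jet2 \<Rightarrow> real"
  assumes "f differentiable (at p)"
  shows "dir_deriv (jet a1 a2 a3 a4 a5 a6 a7 a8 a9) f p =
    a1 * dir_deriv e_t f p + a2 * dir_deriv e_x f p + a3 * dir_deriv e_u f p +
    a4 * dir_deriv e_ut f p + a5 * dir_deriv e_ux f p + a6 * dir_deriv e_utt f p +
    a7 * dir_deriv e_utx f p + a8 * dir_deriv e_uxx f p + a9 * dir_deriv e_b f p"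
proof -
  have lin: "linear (\<lambda>v. dir_deriv v f p)"
    using linear_frechet_derivative[OF assms] unfolding dir_deriv_def by simp
  have "jet a1 a2 a3 a4 a5 a6 a7 a8 a9 =
      a1 *\<^sub>R e_t + a2 *\<^sub>R e_x + a3 *\<^sub>R e_u + a4 *\<^sub>R e_ut + a5 *\<^sub>R e_ux + a6 *\<^sub>R e_utt + a7 *\<^sub>R e_utx +
      a8 *\<^sub>R e_uxx + a9 *\<^sub>R e_b"
    by simp
  then show ?thesis
    by (simp only: linear_add[OF lin] linear_cmul[OF lin] real_scaleR_def)
qed

lemma dir_deriv_bounded_linear:
  assumes "bounded_linear h" "f differentiable (at p)"
  shows "dir_deriv v (\<lambda>x. h (f x)) p = h (dir_deriv v f p)"
  using bounded_linear.has_derivative[OF assms(1) has_derivative_dir_deriv[OF assms(2)]]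
  by (rule dir_deriv_eqI)

lemma smooth_on_bounded_linear_comp:
  "bounded_linear h \<Longrightarrow> smooth_on S f \<Longrightarrow> smooth_on S (\<lambda>x. h (f x))"
  unfolding smooth_on_def using differentiable_order_bounded_linear_comp by blast

lemma open_along_line:
  fixes p v :: "'a::real_normed_vector"
  assumes "open S" "p \<in> S"
  obtains r where "r > 0" "\<And>s. \<bar>s\<bar> < r \<Longrightarrow> p + s *\<^sub>R v \<in> S"
proof -
  have "open ((\<lambda>s. p + s *\<^sub>R v) -` S)"
    using assms by (intro open_vimage continuous_intros)
  moreover have "0 \<in> (\<lambda>s. p + s *\<^sub>R v) -` S"
    using assms by simp
  ultimately obtain r where "r > 0" "ball 0 r \<subseteq> (\<lambda>s. p + s *\<^sub>R v) -` S"
    using openE by blast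
  then show thesis
    by (intro that[of r]) (auto simp: subset_iff)
qed

locale equivalence_transformation =
  fixes \<epsilon> :: real and D :: "ext_jet2 set" and \<Phi> :: "ext_jet2 \<Rightarrow> ext_jet2"
  assumes eps_nonzero: "\<epsilon> \<noteq> 0" and in_group: "(D, \<Phi>) \<in> equivalence_group \<epsilon>"
begin

text \<open>
  \<open>P, Q\<close> are the transformed \<open>u\<^sub>t, u\<^sub>x\<close>, and \<open>R, S, W\<close> the transformed \<open>u\<^sub>t\<^sub>t, u\<^sub>t\<^sub>x, u\<^sub>x\<^sub>x\<close>.
\<close>

definition T :: "ext_jet2 \<Rightarrow> real" where "T p = fst (fst (fst (\<Phi> p)))"
definition X :: "ext_jet2 \<Rightarrow> real" where "X p = fst (snd (fst (fst (\<Phi> p))))"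
definition U :: "ext_jet2 \<Rightarrow> real" where "U p = snd (snd (fst (fst (\<Phi> p))))"
definition P :: "ext_jet2 \<Rightarrow> real" where "P p = fst (fst (snd (fst (\<Phi> p))))"
definition Q :: "ext_jet2 \<Rightarrow> real" where "Q p = snd (fst (snd (fst (\<Phi> p))))"
definition R :: "ext_jet2 \<Rightarrow> real" where "R p = fst (snd (snd (fst (\<Phi> p))))"
definition S :: "ext_jet2 \<Rightarrow> real" where "S p = fst (snd (snd (snd (fst (\<Phi> p)))))"
definition W :: "ext_jet2 \<Rightarrow> real" where "W p = snd (snd (snd (snd (fst (\<Phi> p)))))"
definition G :: "ext_jet2 \<Rightarrow> real" where "G p = snd (\<Phi> p)"

lemmas component_defs = T_def X_def U_def P_def Q_def R_def S_def W_def G_def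

lemma Phi_eq: "\<Phi> p = jet (T p) (X p) (U p) (P p) (Q p) (R p) (S p) (W p) (G p)"
  by (simp add: component_defs)

lemma open_D: "open D" and connected_D: "connected D" and smooth_Phi: "smooth_on D \<Phi>"
  using in_group unfolding equivalence_group_def admissible_domain_def diffeomorphism_on_def by auto

lemma bounded_linear_components:
  "bounded_linear (\<lambda>q::ext_jet2. fst (fst (fst q)))"
  "bounded_linear (\<lambda>q::ext_jet2. fst (snd (fst (fst q))))"
  "bounded_linear (\<lambda>q::ext_jet2. snd (snd (fst (fst q))))"
  "bounded_linear (\<lambda>q::ext_jet2. fst (fst (snd (fst q))))"
  "bounded_linear (\<lambda>q::ext_jet2. snd (fst (snd (fst q))))"
  "bounded_linear (\<lambda>q::ext_jet2. fst (snd (snd (fst q))))"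
  "bounded_linear (\<lambda>q::ext_jet2. fst (snd (snd (snd (fst q)))))"
  "bounded_linear (\<lambda>q::ext_jet2. snd (snd (snd (snd (fst q)))))"
  "bounded_linear (\<lambda>q::ext_jet2. snd q)"
  unfolding linear_conv_bounded_linear[symmetric] by (auto intro!: linearI)

lemma smooth_components [simp]:
  "smooth_on D T" "smooth_on D X" "smooth_on D U" "smooth_on D P" "smooth_on D Q"
  "smooth_on D R" "smooth_on D S" "smooth_on D W" "smooth_on D G"
  unfolding component_defs
  by (rule bounded_linear_components[THEN smooth_on_bounded_linear_comp, OF smooth_Phi])+

lemma smooth_dir_deriv [simp]: "smooth_on D f \<Longrightarrow> smooth_on D (dir_deriv v f)"
  by (rule smooth_on_dir_deriv[OF open_D])

lemma differentiable_if_smooth [simp]: "smooth_on D f \<Longrightarrow> p \<in> D \<Longrightarrow> f differentiable (at p)"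
  by (rule smooth_on_imp_differentiable)

lemma dir_deriv_Phi:
  assumes "p \<in> D"
  shows "dir_deriv v \<Phi> p = jet (dir_deriv v T p) (dir_deriv v X p) (dir_deriv v U p)
    (dir_deriv v P p) (dir_deriv v Q p) (dir_deriv v R p) (dir_deriv v S p) (dir_deriv v W p)
    (dir_deriv v G p)"
  unfolding component_defs
  using bounded_linear_components[THEN dir_deriv_bounded_linear,
      OF smooth_on_imp_differentiable[OF smooth_Phi assms]]
  by simp

section \<open>Invertibility of the transformation and of its derivative\<close>

lemma inj_Phi: "p \<in> D \<Longrightarrow> q \<in> D \<Longrightarrow> \<Phi> p = \<Phi> q \<Longrightarrow> p = q"
  using in_group unfolding equivalence_group_def diffeomorphism_on_def inj_on_def by blast

text \<open>Differentiating the identity that \<open>\<Psi>\<close> composed with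
  \<open>\<Phi>\<close> satisfies on \<open>D\<close> yields a left inverse of the
  derivative.\<close>

lemma inj_dir_deriv_Phi:
  assumes p: "p \<in> D"
  shows "inj (\<lambda>v. dir_deriv v \<Phi> p)"
proof -
  define \<Psi> where "\<Psi> = the_inv_into D \<Phi>"
  have inj: "inj_on \<Phi> D" and "smooth_on (\<Phi> ` D) \<Psi>"
    using in_group unfolding equivalence_group_def diffeomorphism_on_def \<Psi>_def by auto
  then have "(\<Psi> has_derivative (\<lambda>v. dir_deriv v \<Psi> (\<Phi> p))) (at (\<Phi> p))"
    using p smooth_on_imp_differentiable has_derivative_dir_deriv by blast
  from has_derivative_compose[OF
      has_derivative_dir_deriv[OF smooth_on_imp_differentiable[OF smooth_Phi p]] this]
  have "((\<lambda>q. \<Psi> (\<Phi> q)) has_derivative (\<lambda>v. dir_deriv (dir_deriv v \<Phi> p) \<Psi> (\<Phi> p))) (at p)" .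
  then have "((\<lambda>q. q) has_derivative (\<lambda>v. dir_deriv (dir_deriv v \<Phi> p) \<Psi> (\<Phi> p))) (at p)"
    by (rule has_derivative_transform_within_open[OF _ open_D p])
      (simp add: \<Psi>_def the_inv_into_f_f[OF inj])
  then have "(\<lambda>v. dir_deriv (dir_deriv v \<Phi> p) \<Psi> (\<Phi> p)) = (\<lambda>v. v)"
    using has_derivative_unique has_derivative_ident by blast
  then show ?thesis
    by (intro inj_on_inverseI[where g = "\<lambda>v. dir_deriv v \<Psi> (\<Phi> p)"]) (rule fun_cong)
qed

lemma surj_dir_deriv_Phi:
  assumes p: "p \<in> D"
  shows "surj (\<lambda>v. dir_deriv v \<Phi> p)"
proof -
  have "linear (\<lambda>v. dir_deriv v \<Phi> p)"
    using linear_frechet_derivative[OF smooth_on_imp_differentiable[OF smooth_Phi p]]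
    unfolding dir_deriv_def by simp
  then show ?thesis
    using inj_dir_deriv_Phi[OF p] by (rule linear_inj_imp_surj)
qed

text \<open>Two points over one base point may lie in different components of the fibre, so
  vanishing fibre derivatives would say less. Comparing arbitrary points lets values be moved to any
  jet over the same base point, in particular to one on an equation.\<close>

definition depends_on_base :: "(ext_jet2 \<Rightarrow> real) \<Rightarrow> bool" where
  "depends_on_base f \<longleftrightarrow> (\<forall>p\<in>D. \<forall>q\<in>D. fst (fst p) = fst (fst q) \<longrightarrow> f p = f q)"

lemma depends_on_baseD:
  "depends_on_base f \<Longrightarrow> p \<in> D \<Longrightarrow> q \<in> D \<Longrightarrow> fst (fst p) = fst (fst q) \<Longrightarrow> f p = f q"
  unfolding depends_on_base_def by blast

lemma depends_on_base_components [simp]: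
  "depends_on_base T" "depends_on_base X" "depends_on_base U"
proof -
  obtain \<phi> :: "base \<Rightarrow> base" where "\<forall>p\<in>D. fst (fst (\<Phi> p)) = \<phi> (fst (fst p))"
    using in_group unfolding equivalence_group_def projectable_def by blast
  then have *: "fst (fst (\<Phi> p)) = fst (fst (\<Phi> q))"
    if "p \<in> D" "q \<in> D" "fst (fst p) = fst (fst q)" for p q
    using that by simp
  show "depends_on_base T" "depends_on_base X" "depends_on_base U"
    unfolding depends_on_base_def T_def X_def U_def by (intro ballI impI; drule (2) *; simp)+
qed

text \<open>Restricted to the two lines, \<open>f\<close> is one and the same function of the real
  parameter near 0.\<close>

lemma same_derivative_if_agree:
  assumes "smooth_on D f" "p \<in> D" "q \<in> D"
    and agree: "\<And>s. p + s *\<^sub>R v \<in> D \<Longrightarrow> q + s *\<^sub>R w \<in> D \<Longrightarrow> f (p + s *\<^sub>R v) = f (q + s *\<^sub>R w)"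
  shows "dir_deriv v f p = dir_deriv w f q"
proof -
  define A where "A = (\<lambda>s. p + s *\<^sub>R v) -` D \<inter> (\<lambda>s. q + s *\<^sub>R w) -` D"
  have A: "open A" "0 \<in> A"
    unfolding A_def using assms open_D by (auto intro!: open_Int open_vimage continuous_intros)
  have "((\<lambda>s. f (p + s *\<^sub>R v)) has_vector_derivative dir_deriv v f p) (at 0)"
    using has_vector_derivative_along_line[of f p 0 v UNIV] assms by simp
  then have "((\<lambda>s. f (q + s *\<^sub>R w)) has_vector_derivative dir_deriv v f p) (at 0)"
    by (rule has_vector_derivative_transform_within_open[OF _ A]) (use agree in \<open>auto simp: A_def\<close>)
  moreover have "((\<lambda>s. f (q + s *\<^sub>R w)) has_vector_derivative dir_deriv w f q) (at 0)"
    using has_vector_derivative_along_line[of f q 0 w UNIV] assms by simp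
  ultimately show ?thesis
    by (rule vector_derivative_unique_at)
qed

text \<open>The lines through \<open>p\<close> along \<open>v\<close> and through \<open>q\<close>
  along \<open>w\<close> project to the same line in the base.\<close>

lemma dir_deriv_depends_on_base:
  assumes "smooth_on D f" "depends_on_base f" "p \<in> D" "q \<in> D"
    and "fst (fst p) = fst (fst q)" "fst (fst v) = fst (fst w)"
  shows "dir_deriv v f p = dir_deriv w f q"
  by (rule same_derivative_if_agree[OF assms(1,3,4)], erule (1) depends_on_baseD[OF assms(2)])
    (simp add: assms(5,6))

lemma depends_on_base_dir_deriv [simp]:
  "smooth_on D f \<Longrightarrow> depends_on_base f \<Longrightarrow> depends_on_base (dir_deriv v f)"
  using dir_deriv_depends_on_base unfolding depends_on_base_def by blast

lemma dir_deriv_fibre: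
  assumes "smooth_on D f" "depends_on_base f" "p \<in> D" "fst (fst v) = 0"
  shows "dir_deriv v f p = 0"
proof -
  have "dir_deriv v f p = dir_deriv 0 f p"
    using assms by (intro dir_deriv_depends_on_base) simp_all
  also have "\<dots> = 0"
    using assms by (simp add: dir_deriv_zero)
  finally show ?thesis .
qed

lemma dir_deriv_base:
  assumes "smooth_on D f" "depends_on_base f" "p \<in> D"
  shows "dir_deriv (jet a1 a2 a3 a4 a5 a6 a7 a8 a9) f p =
    a1 * dir_deriv e_t f p + a2 * dir_deriv e_x f p + a3 * dir_deriv e_u f p"
proof -
  have "dir_deriv v f p = 0" if "v \<in> {e_ut, e_ux, e_utt, e_utx, e_uxx, e_b}" for v
    using that by (intro dir_deriv_fibre[OF assms]) (auto simp: zero_prod_def)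
  then show ?thesis
    using assms(1,3) by (subst dir_deriv_jet) simp_all
qed

section \<open>Testing the transformation on constant and affine arbitrary elements\<close>

lemma transformed_arbitrary_element:
  assumes "smooth_on UNIV B"
  obtains J B' where "arbitrary_element J B'"
    "\<forall>p\<in>D. snd p = B (x_coord (fst p)) \<longrightarrow> X p \<in> J \<and> G p = B' (X p)"
    "\<forall>t x u ux utt utx uxx. jet t x u (\<epsilon> * uxx + B x * ux) ux utt utx uxx (B x) \<in> D \<longrightarrow>
       fst (\<Phi> (jet t x u (\<epsilon> * uxx + B x * ux) ux utt utx uxx (B x))) \<in> kolmogorov_eq \<epsilon> J B'"
proof -
  \<comment> \<open>With the whole real line as interval, only \<open>D\<close> restricts the jets
    to which the mapping property applies.\<close>
  have "arbitrary_element UNIV B"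
    using assms unfolding arbitrary_element_def by simp
  then obtain J B' where B': "arbitrary_element J B'" "maps_equation \<epsilon> D \<Phi> UNIV B J B'"
    using in_group unfolding equivalence_group_def by blast
  show thesis
  proof (rule that[OF B'(1)]; intro ballI allI impI)
    fix p assume "p \<in> D" "snd p = B (x_coord (fst p))"
    then have p: "(fst p, B (x_coord (fst p))) = p"
      by (metis prod.collapse)
    then have "fst p \<in> jet_domain D UNIV B"
      using \<open>p \<in> D\<close> unfolding jet_domain_def by simp
    then have "x_coord (fst (\<Phi> (fst p, B (x_coord (fst p))))) \<in> J \<and>
        snd (\<Phi> (fst p, B (x_coord (fst p)))) =
          B' (x_coord (fst (\<Phi> (fst p, B (x_coord (fst p))))))"
      using B'(2) unfolding maps_equation_def Let_def by blast
    then show "X p \<in> J \<and> G p = B' (X p)"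
      unfolding p by (simp add: X_def G_def x_coord_def)
  next
    fix t x u ux utt utx uxx
    let ?p = "jet t x u (\<epsilon> * uxx + B x * ux) ux utt utx uxx (B x)"
    assume "?p \<in> D"
    then have "fst ?p \<in> jet_domain D UNIV B \<inter> kolmogorov_eq \<epsilon> UNIV B"
      unfolding jet_domain_def kolmogorov_eq_def x_coord_def by auto
    then have "(fst \<circ> (\<lambda>z. \<Phi> (z, B (x_coord z)))) (fst ?p) \<in> kolmogorov_eq \<epsilon> J B'"
      using B'(2) unfolding maps_equation_def Let_def by blast
    then show "fst (\<Phi> ?p) \<in> kolmogorov_eq \<epsilon> J B'"
      by (simp add: x_coord_def)
  qed
qed

lemma smooth_const: "smooth_on A (\<lambda>x::real. c::real)"
  unfolding smooth_on_def using differentiable_order_const by blast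

text \<open>The graph of the constant element \<open>b\<close> passes through the given point. There
  \<open>G\<close> is the value of the transformed element, which turns the transformed equation
  into a relation between components of \<open>\<Phi>\<close>.\<close>

lemma transformed_equation:
  assumes "jet t x u (\<epsilon> * uxx + b * ux) ux utt utx uxx b \<in> D" (is "?p \<in> D")
  shows "P ?p = \<epsilon> * W ?p + G ?p * Q ?p"
proof -
  obtain J B' where "arbitrary_element J B'"
    and G: "\<forall>p\<in>D. snd p = b \<longrightarrow> X p \<in> J \<and> G p = B' (X p)"
    and eq: "\<forall>t x u ux utt utx uxx. jet t x u (\<epsilon> * uxx + b * ux) ux utt utx uxx b \<in> D \<longrightarrow>
       fst (\<Phi> (jet t x u (\<epsilon> * uxx + b * ux) ux utt utx uxx b)) \<in> kolmogorov_eq \<epsilon> J B'"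
    by (rule transformed_arbitrary_element[OF smooth_const[of UNIV b]])
  have "G ?p = B' (X ?p)"
    using G[THEN bspec, OF assms] by simp
  moreover have "P ?p = \<epsilon> * W ?p + B' (X ?p) * Q ?p"
    using eq[rule_format, OF assms] by (simp only: Phi_eq fst_conv kolmogorov_eq_iff)
  ultimately show ?thesis
    by simp
qed

text \<open>Both points lie on the graph of one constant element; its transform is a function of
  \<open>X\<close>, and \<open>X\<close> agrees at the two points.\<close>

lemma G_eq:
  assumes "p \<in> D" "q \<in> D" "fst (fst p) = fst (fst q)" "snd p = snd q"
  shows "G p = G q"
proof -
  obtain J B' where "arbitrary_element J B'"
    and G: "\<forall>q\<in>D. snd q = snd p \<longrightarrow> X q \<in> J \<and> G q = B' (X q)"
    and "\<forall>t x u ux utt utx uxx.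
       jet t x u (\<epsilon> * uxx + snd p * ux) ux utt utx uxx (snd p) \<in> D \<longrightarrow>
       fst (\<Phi> (jet t x u (\<epsilon> * uxx + snd p * ux) ux utt utx uxx (snd p))) \<in> kolmogorov_eq \<epsilon> J B'"
    by (rule transformed_arbitrary_element[OF smooth_const[of UNIV "snd p"]])
  have "X p = X q"
    by (rule depends_on_baseD[OF depends_on_base_components(2) assms(1-3)])
  then show ?thesis
    using G[rule_format, OF assms(1) refl] G[rule_format, OF assms(2) assms(4)[symmetric]] by simp
qed

text \<open>The jet coordinates are fixed along \<open>e_b\<close>, so projectability to the jet
  space makes these components constant there; the zero direction serves as the comparison
  line.\<close>

lemma dir_deriv_psi_b:
  assumes f: "f \<in> {T, X, U, P, Q, R, S, W}" and p: "p \<in> D"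
  shows "dir_deriv e_b f p = 0"
proof -
  obtain \<psi> :: "jet2 \<Rightarrow> jet2" where "\<forall>p\<in>D. fst (\<Phi> p) = \<psi> (fst p)"
    using in_group unfolding equivalence_group_def projectable_def by blast
  then have *: "fst (\<Phi> p) = fst (\<Phi> q)" if "p \<in> D" "q \<in> D" "fst p = fst q" for p q
    using that by simp
  then have f_eq: "f p = f q" if "p \<in> D" "q \<in> D" "fst p = fst q" for p q
    using f *[OF that] by (elim insertE emptyE) (simp_all only: component_defs)
  have "smooth_on D f"
    using f by auto
  then have "dir_deriv e_b f p = dir_deriv 0 f p"
    by (rule same_derivative_if_agree[OF _ p p], intro f_eq) (simp_all add: zero_prod_def)
  also have "\<dots> = 0"
    using p \<open>smooth_on D f\<close> by (simp add: dir_deriv_zero)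
  finally show ?thesis .
qed

text \<open>All other components are insensitive to \<open>e_b\<close>, so a zero derivative of
  \<open>G\<close> would put \<open>e_b\<close> into the kernel of an injective map.\<close>

lemma G_b_nonzero:
  assumes "p \<in> D"
  shows "dir_deriv e_b G p \<noteq> 0"
proof
  assume "dir_deriv e_b G p = 0"
  then have "dir_deriv e_b \<Phi> p = 0"
    using assms by (simp add: dir_deriv_Phi dir_deriv_psi_b zero_prod_def)
  also have "0 = dir_deriv 0 \<Phi> p"
    using smooth_on_imp_differentiable[OF smooth_Phi assms] by (simp add: dir_deriv_zero)
  finally have "e_b = 0"
    by (rule injD[OF inj_dir_deriv_Phi[OF assms]])
  then show False
    by (simp add: zero_prod_def)
qed

text \<open>
  Compare the transformed arbitrary elements of \<open>B = const\<close> and of \<open>B = x + const\<close>: both are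
  functions of \<open>X\<close>, while the values of \<open>B\<close> differ to first order along a direction in which
  \<open>x\<close> varies.
\<close>

lemma x_constant_if_X_constant:
  assumes p: "p \<in> D" and v: "dir_deriv (jet a1 a2 a3 a4 a5 a6 a7 a8 0) X p = 0" (is "dir_deriv ?v X p = 0")
  shows "a2 = 0"
proof -
  \<comment> \<open>On a line that stays on the graph of \<open>B\<close>, \<open>G\<close> is
    \<open>B'\<close> composed with \<open>X\<close>; by the chain rule its derivative vanishes
    together with that of \<open>X\<close>.\<close>
  have zero: "dir_deriv w G p = 0"
    if w: "dir_deriv w X p = 0" and B: "smooth_on UNIV B"
      and along: "\<And>s. snd (p + s *\<^sub>R w) = B (x_coord (fst (p + s *\<^sub>R w)))" for w B
  proof -
    obtain J B' where B': "arbitrary_element J B'"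
      "\<forall>p\<in>D. snd p = B (x_coord (fst p)) \<longrightarrow> X p \<in> J \<and> G p = B' (X p)"
      "\<forall>t x u ux utt utx uxx. jet t x u (\<epsilon> * uxx + B x * ux) ux utt utx uxx (B x) \<in> D \<longrightarrow>
        fst (\<Phi> (jet t x u (\<epsilon> * uxx + B x * ux) ux utt utx uxx (B x))) \<in> kolmogorov_eq \<epsilon> J B'"
      by (rule transformed_arbitrary_element[OF B])
    have "X p \<in> J"
      using B'(2)[THEN bspec, OF p] along[of 0] by simp
    then have "B' differentiable (at (X p))"
      using B'(1) smooth_on_imp_differentiable unfolding arbitrary_element_def by blast
    note has_derivative_dir_deriv[OF this]
    moreover have "((\<lambda>s. X (p + s *\<^sub>R w)) has_derivative (\<lambda>h. 0)) (at 0)"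
      using has_vector_derivative_along_line[of X p 0 w UNIV] p w
      unfolding has_vector_derivative_def by simp
    ultimately have "((\<lambda>s. B' (X (p + s *\<^sub>R w))) has_derivative (\<lambda>h. dir_deriv 0 B' (X p))) (at 0)"
      using has_derivative_compose[of "\<lambda>s. X (p + s *\<^sub>R w)" "\<lambda>h. 0" 0 UNIV B'] by simp
    moreover have "dir_deriv 0 B' (X p) = 0"
      by (rule dir_deriv_zero) fact
    ultimately have "((\<lambda>s. B' (X (p + s *\<^sub>R w))) has_vector_derivative 0) (at 0)"
      unfolding has_vector_derivative_def by simp
    moreover have "open ((\<lambda>s. p + s *\<^sub>R w) -` D)"
      using open_D by (intro open_vimage continuous_intros)
    ultimately have "((\<lambda>s. G (p + s *\<^sub>R w)) has_vector_derivative 0) (at 0)"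
      by (rule has_vector_derivative_transform_within_open) (use p B'(2) along in auto)
    moreover have "((\<lambda>s. G (p + s *\<^sub>R w)) has_vector_derivative dir_deriv w G p) (at 0)"
      using has_vector_derivative_along_line[of G p 0 w UNIV] p by simp
    ultimately show ?thesis
      using vector_derivative_unique_at by blast
  qed
  \<comment> \<open>Along \<open>?w\<close> the value b grows at the same rate as x, which keeps the
    line on a graph of slope 1; \<open>X\<close> does not notice the change of direction.\<close>
  let ?w = "?v + a2 *\<^sub>R e_b"
  have "dir_deriv ?v G p = 0"
    by (rule zero[OF v smooth_const[of _ "snd p"]]) simp
  moreover have "dir_deriv ?w G p = 0"
  proof (rule zero)
    show "dir_deriv ?w X p = 0"
      using v p dir_deriv_base[of X p a1 a2 a3 a4 a5 a6 a7 a8]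
      by simp
    \<comment> \<open>The additive constant makes the graph pass through \<open>p\<close>.\<close>
    show "smooth_on UNIV (\<lambda>x. x + (snd p - x_coord (fst p)))"
      by (rule smooth_on_affine) (rule bounded_linear_ident)
  qed (simp add: x_coord_def)
  moreover have "dir_deriv ?w G p = dir_deriv ?v G p + a2 * dir_deriv e_b G p"
    using p dir_deriv_jet[of G p a1 a2 a3 a4 a5 a6 a7 a8] by simp
  ultimately show ?thesis
    using G_b_nonzero[OF p] by simp
qed

text \<open>A direction with fixed b that annihilates \<open>X\<close> has no x-component. This
  excludes \<open>e_x\<close>, and the two combinations below annihilate \<open>X\<close> while
  their x-components are the negatives of X_t and X_u.\<close>

lemma X_derivatives:
  assumes "p \<in> D"
  shows "dir_deriv e_x X p \<noteq> 0" "dir_deriv e_t X p = 0" "dir_deriv e_u X p = 0"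
proof -
  show x: "dir_deriv e_x X p \<noteq> 0"
    using x_constant_if_X_constant[OF assms, of 0 1 0 0 0 0 0 0] by auto
  have "dir_deriv (jet (dir_deriv e_x X p) (- dir_deriv e_t X p) 0 0 0 0 0 0 0) X p = 0"
    "dir_deriv (jet 0 (- dir_deriv e_u X p) (dir_deriv e_x X p) 0 0 0 0 0 0) X p = 0"
    using assms
      dir_deriv_base[of X p "dir_deriv e_x X p" "- dir_deriv e_t X p" 0 0 0 0 0 0 0]
      dir_deriv_base[of X p 0 "- dir_deriv e_u X p" "dir_deriv e_x X p" 0 0 0 0 0 0]
    by simp_all
  from this[THEN x_constant_if_X_constant[OF assms]]
  show "dir_deriv e_t X p = 0" "dir_deriv e_u X p = 0"
    by simp_all
qed

section \<open>Consequences of the contact conditions\<close>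

lemma contact:
  assumes "jet t x u ut ux utt utx uxx b \<in> D" (is "?p \<in> D")
    and "v = jet dt dx (ut * dt + ux * dx) (utt * dt + utx * dx) (utx * dt + uxx * dx) d1 d2 d3 d4"
  shows "dir_deriv v U ?p = P ?p * dir_deriv v T ?p + Q ?p * dir_deriv v X ?p"
    "dir_deriv v P ?p = R ?p * dir_deriv v T ?p + S ?p * dir_deriv v X ?p"
    "dir_deriv v Q ?p = S ?p * dir_deriv v T ?p + W ?p * dir_deriv v X ?p"
proof -
  \<comment> \<open>\<open>v\<close> is a general contact vector: \<open>dt\<close> and
    \<open>dx\<close> fix its lower components, while \<open>d1\<close> to \<open>d4\<close> are
    free. Total derivative vectors and \<open>e_utt\<close> are the instances used later.\<close>
  have "fst v \<in> contact_space (fst ?p)"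
    unfolding assms(2) fst_conv contact_space_iff by blast
  moreover have "contact_preserving D \<Phi>"
    using in_group unfolding equivalence_group_def by blast
  ultimately have "fst (dir_deriv v \<Phi> ?p) \<in> contact_space (fst (\<Phi> ?p))"
    using assms(1) unfolding contact_preserving_def dir_deriv_def by blast
  then show "dir_deriv v U ?p = P ?p * dir_deriv v T ?p + Q ?p * dir_deriv v X ?p"
    "dir_deriv v P ?p = R ?p * dir_deriv v T ?p + S ?p * dir_deriv v X ?p"
    "dir_deriv v Q ?p = S ?p * dir_deriv v T ?p + W ?p * dir_deriv v X ?p"
    by (simp_all only: Phi_eq[of ?p] dir_deriv_Phi[OF assms(1)] fst_conv contact_space_iff)
qed

text \<open>\<open>e_utt\<close> is a contact vector along which neither \<open>T\<close> nor
  \<open>X\<close> varies, so the right-hand sides of the contact conditions vanish.\<close>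

lemma first_order_components_utt:
  assumes "p \<in> D"
  shows "dir_deriv e_utt P p = 0" "dir_deriv e_utt Q p = 0"
proof -
  obtain t x u ut ux utt utx uxx b where p: "p = jet t x u ut ux utt utx uxx b"
    by (metis surj_pair)
  have "dir_deriv e_utt T p = 0" "dir_deriv e_utt X p = 0"
    using assms by (auto intro!: dir_deriv_fibre simp: zero_prod_def)
  then show "dir_deriv e_utt P p = 0" "dir_deriv e_utt Q p = 0"
    using contact(2,3)[of t x u ut ux utt utx uxx b e_utt 0 0 1 0 0 0] assms unfolding p by auto
qed

subsection \<open>Determining equations\<close>

text \<open>
  If \<open>D\<^sub>x T \<noteq> 0\<close>, the transformed equation and the contact conditions force every component of
  \<open>\<Phi>\<close> to be constant along \<open>e_utt\<close>, which contradicts injectivity.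
\<close>

lemma total_x_derivative_T_zero:
  assumes p: "jet t x u (\<epsilon> * uxx + b * ux) ux utt utx uxx b \<in> D" (is "?p \<in> D")
  shows "dir_deriv e_x T ?p + ux * dir_deriv e_u T ?p = 0"
proof (rule ccontr)
  let ?v = "jet 0 1 ux utx uxx 0 0 0 0"
  assume "dir_deriv e_x T ?p + ux * dir_deriv e_u T ?p \<noteq> 0"
  then have Tv: "dir_deriv ?v T ?p \<noteq> 0"
    using dir_deriv_base[of T ?p 0 1 ux utx uxx 0 0 0 0] p by simp
  obtain r where r: "r > 0" "ball ?p r \<subseteq> D"
    using p open_D openE by blast
  obtain s where s: "s > 0" "\<And>h. \<bar>h\<bar> < s \<Longrightarrow> ?p + h *\<^sub>R e_utt \<in> ball ?p r"
    using open_along_line[of "ball ?p r" ?p e_utt] r(1) by auto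
  \<comment> \<open>The second point differs from \<open>?p\<close> in u_tt only. Since u_tt does
    not occur in the equation, both points satisfy it.\<close>
  define q where "q = ?p + (s / 2) *\<^sub>R e_utt"
  have q_jet: "q = jet t x u (\<epsilon> * uxx + b * ux) ux (utt + s / 2) utx uxx b"
    unfolding q_def by simp
  have q_ball: "q \<in> ball ?p r"
    unfolding q_def using s(1) by (intro s(2)) simp
  then have q: "q \<in> D"
    using r by blast
  \<comment> \<open>Functions constant along \<open>e_utt\<close> have equal values and equal
    \<open>?v\<close>-derivatives at the two points; this is used for
    \<open>T, X, U, P, Q\<close>.\<close>
  have const: "f q = f ?p \<and> dir_deriv ?v f q = dir_deriv ?v f ?p"
    if f: "smooth_on D f" "\<And>y. y \<in> D \<Longrightarrow> dir_deriv e_utt f y = 0" for f :: "ext_jet2 \<Rightarrow> real"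
  proof
    have f': "\<And>y. y \<in> ball ?p r \<Longrightarrow> f differentiable (at y)"
        "\<And>y. y \<in> ball ?p r \<Longrightarrow> dir_deriv e_utt f y = 0"
      using r f by (auto intro: smooth_on_imp_differentiable)
    show "f q = f ?p"
      unfolding q_def
      by (rule constant_along_direction[OF convex_ball f'])
        (use r q_ball in \<open>simp_all only: q_def[symmetric] centre_in_ball\<close>)
    show "dir_deriv ?v f q = dir_deriv ?v f ?p"
      unfolding q_def
      by (rule dir_deriv_constant_along_direction[OF convex_ball open_ball f'])
        (use r q_ball in \<open>simp_all only: q_def[symmetric] centre_in_ball\<close>)
  qed
  have base: "dir_deriv e_utt f y = 0" if "smooth_on D f" "depends_on_base f" "y \<in> D" for f y
    using that by (intro dir_deriv_fibre) (simp_all add: zero_prod_def)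
  have T: "T q = T ?p" "dir_deriv ?v T q = dir_deriv ?v T ?p"
    and X: "X q = X ?p" "dir_deriv ?v X q = dir_deriv ?v X ?p"
    and U: "U q = U ?p" "dir_deriv ?v U q = dir_deriv ?v U ?p"
    using const[of T] const[of X] const[of U] base by simp_all
  have P: "P q = P ?p" "dir_deriv ?v P q = dir_deriv ?v P ?p"
    and Q: "Q q = Q ?p" "dir_deriv ?v Q q = dir_deriv ?v Q ?p"
    using const[of P] const[of Q] first_order_components_utt by simp_all
  have G: "G q = G ?p"
    by (rule G_eq[OF q p]) (simp_all add: q_jet)
  have "P ?p = \<epsilon> * W ?p + G ?p * Q ?p" "P q = \<epsilon> * W q + G q * Q q"
    using transformed_equation p q unfolding q_jet by blast+
  then have W: "W q = W ?p"
    using P(1) Q(1) G eps_nonzero by simp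
  \<comment> \<open>The factors 0 and 1 are spelled out to match the pattern of
    \<open>contact\<close>; u_tt is multiplied by 0, so one direction serves both points.\<close>
  have v: "?v = jet 0 1 ((\<epsilon> * uxx + b * ux) * 0 + ux * 1) (utt' * 0 + utx * 1) (utx * 0 + uxx * 1) 0 0 0 0"
    for utt'
    by simp
  note contact_p = contact(2,3)[OF p v[of utt]]
  note contact_q = contact(2,3)[OF q[unfolded q_jet] v[of "utt + s / 2"], folded q_jet]
  \<comment> \<open>\<open>S\<close>, and after it \<open>R\<close>, is recovered from a contact
    condition by dividing by the nonzero derivative of \<open>T\<close> along
    \<open>?v\<close>.\<close>
  have S: "S q = S ?p"
    using contact_p(2) contact_q(2) T X Q W Tv by simp
  have R: "R q = R ?p"
    using contact_p(1) contact_q(1) T X P S Tv by simp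
  have "\<Phi> q = \<Phi> ?p"
    unfolding Phi_eq[of q] Phi_eq[of ?p] using T X U P Q R S W G by simp
  then have "q = ?p"
    using inj_Phi p q by blast
  then show False
    using s(1) unfolding q_jet by simp
qed

text \<open>This carries results found on equations to every point of \<open>D\<close>: the base
  point and b are kept, and only the derivatives of u change.\<close>

lemma equation_point:
  assumes "jet t x u ut ux utt utx uxx b \<in> D"
  obtains ux utt utx uxx where "jet t x u (\<epsilon> * uxx + b * ux) ux utt utx uxx b \<in> D"
proof -
  have "admissible_domain \<epsilon> D"
    using in_group unfolding equivalence_group_def by blast
  then have "\<exists>ut ux utt utx uxx. jet t x u ut ux utt utx uxx b \<in> D \<and> ut = \<epsilon> * uxx + b * ux"
    using assms unfolding admissible_domain_def by blast
  then show thesis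
    using that by blast
qed

text \<open>On the equation T_x + u_x T_u vanishes; two values of u_x over the same base point
  separate the two terms.\<close>

lemma T_spatial_derivatives:
  assumes "p \<in> D"
  shows "dir_deriv e_x T p = 0" "dir_deriv e_u T p = 0"
proof -
  obtain t x u ut ux utt utx uxx b where p_jet: "p = jet t x u ut ux utt utx uxx b"
    by (metis surj_pair)
  obtain ux utt utx uxx where e: "jet t x u (\<epsilon> * uxx + b * ux) ux utt utx uxx b \<in> D" (is "?e \<in> D")
    by (rule equation_point[OF assms[unfolded p_jet]])
  \<comment> \<open>The direction raises u_x by 1 and u_t by b, so it preserves u_t = \<epsilon>
    u_xx + b u_x.\<close>
  obtain r where r: "r > 0" "\<And>s. \<bar>s\<bar> < r \<Longrightarrow> ?e + s *\<^sub>R (jet 0 0 0 b 1 0 0 0 0) \<in> D"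
    using open_along_line[OF open_D e] by blast
  have "jet t x u (\<epsilon> * uxx + b * (ux + r / 2)) (ux + r / 2) utt utx uxx b
      = ?e + (r / 2) *\<^sub>R (jet 0 0 0 b 1 0 0 0 0)"
    by (simp add: algebra_simps)
  also have "\<dots> \<in> D"
    using r(1) by (intro r(2)) simp
  finally have q: "jet t x u (\<epsilon> * uxx + b * (ux + r / 2)) (ux + r / 2) utt utx uxx b \<in> D" (is "?q \<in> D") .
  have eq: "dir_deriv w T ?e = dir_deriv w T p" "dir_deriv w T ?q = dir_deriv w T p" for w
    using e q assms by (auto intro!: dir_deriv_depends_on_base simp: p_jet)
  have zero: "dir_deriv e_x T p + ux * dir_deriv e_u T p = 0"
    "dir_deriv e_x T p + (ux + r / 2) * dir_deriv e_u T p = 0"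
    using total_x_derivative_T_zero[OF e] total_x_derivative_T_zero[OF q] unfolding eq .
  then have "r / 2 * dir_deriv e_u T p = 0"
    by (simp only: distrib_right)
  then show "dir_deriv e_u T p = 0"
    using r(1) by simp
  then show "dir_deriv e_x T p = 0"
    using zero(1) by simp
qed

section \<open>Nondegeneracy and the prolongation formulas\<close>

lemma derivatives_nonzero:
  assumes "p \<in> D"
  shows "dir_deriv e_t T p \<noteq> 0" "dir_deriv e_u U p \<noteq> 0"
proof -
  have T: "dir_deriv (jet a1 a2 a3 a4 a5 a6 a7 a8 a9) T p = a1 * dir_deriv e_t T p"
    for a1 a2 a3 a4 a5 a6 a7 a8 a9
    using dir_deriv_base[of T p a1 a2 a3 a4 a5 a6 a7 a8 a9] assms T_spatial_derivatives by simp
  have X: "dir_deriv (jet a1 a2 a3 a4 a5 a6 a7 a8 a9) X p = a2 * dir_deriv e_x X p"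
    for a1 a2 a3 a4 a5 a6 a7 a8 a9
    using dir_deriv_base[of X p a1 a2 a3 a4 a5 a6 a7 a8 a9] assms X_derivatives by simp
  have surj: "\<exists>a1 a2 a3 a4 a5 a6 a7 a8 a9. dir_deriv (jet a1 a2 a3 a4 a5 a6 a7 a8 a9) \<Phi> p = y" for y
  proof -
    obtain v where v: "dir_deriv v \<Phi> p = y"
      using surjD[OF surj_dir_deriv_Phi[OF assms], of y] by auto
    obtain a1 a2 a3 a4 a5 a6 a7 a8 a9 where "v = jet a1 a2 a3 a4 a5 a6 a7 a8 a9"
      by (metis surj_pair)
    with v show ?thesis
      by blast
  qed
  \<comment> \<open>\<open>T\<close> varies in the t-direction only, so \<open>e_t\<close> can be in
    the image only if T_t is nonzero.\<close>
  obtain a1 a2 a3 a4 a5 a6 a7 a8 a9 where "dir_deriv (jet a1 a2 a3 a4 a5 a6 a7 a8 a9) \<Phi> p = e_t"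
    using surj[of e_t] by blast
  then have "a1 * dir_deriv e_t T p = 1"
    using T[of a1 a2 a3 a4 a5 a6 a7 a8 a9] by (simp add: dir_deriv_Phi[OF assms])
  then show t: "dir_deriv e_t T p \<noteq> 0"
    by auto
  \<comment> \<open>Since T_t and X_x are nonzero, a preimage of \<open>e_u\<close> has no t- and
    x-component; the value 1 for \<open>U\<close> must then come from U_u.\<close>
  obtain a1 a2 a3 a4 a5 a6 a7 a8 a9 where "dir_deriv (jet a1 a2 a3 a4 a5 a6 a7 a8 a9) \<Phi> p = e_u"
    using surj[of e_u] by blast
  then have "a1 * dir_deriv e_t T p = 0" "a2 * dir_deriv e_x X p = 0"
    "dir_deriv (jet a1 a2 a3 a4 a5 a6 a7 a8 a9) U p = 1"
    using T[of a1 a2 a3 a4 a5 a6 a7 a8 a9] X[of a1 a2 a3 a4 a5 a6 a7 a8 a9]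
    by (simp_all add: dir_deriv_Phi[OF assms])
  then have "a3 * dir_deriv e_u U p = 1"
    using dir_deriv_base[of U p a1 a2 a3 a4 a5 a6 a7 a8 a9] assms t X_derivatives(1)[OF assms]
    by simp
  then show "dir_deriv e_u U p \<noteq> 0"
    by auto
qed

text \<open>The contact condition for \<open>U\<close> is evaluated on the total derivative vectors
  in t and in x. Only T_t and X_x survive, so each vector isolates one of \<open>P\<close> and
  \<open>Q\<close>.\<close>

lemma first_prolongation:
  assumes "jet t x u ut ux utt utx uxx b \<in> D" (is "?p \<in> D")
  shows "P ?p * dir_deriv e_t T ?p = dir_deriv e_t U ?p + ut * dir_deriv e_u U ?p"
    "Q ?p * dir_deriv e_x X ?p = dir_deriv e_x U ?p + ux * dir_deriv e_u U ?p"
proof -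
  have "dir_deriv (jet 1 0 ut utt utx 0 0 0 0) U ?p =
      P ?p * dir_deriv (jet 1 0 ut utt utx 0 0 0 0) T ?p +
      Q ?p * dir_deriv (jet 1 0 ut utt utx 0 0 0 0) X ?p"
    by (rule contact(1)[OF assms, of _ 1 0 0 0 0 0]) simp
  then show "P ?p * dir_deriv e_t T ?p = dir_deriv e_t U ?p + ut * dir_deriv e_u U ?p"
    using assms T_spatial_derivatives X_derivatives
      dir_deriv_base[of U ?p 1 0 ut utt utx 0 0 0 0] dir_deriv_base[of T ?p 1 0 ut utt utx 0 0 0 0]
      dir_deriv_base[of X ?p 1 0 ut utt utx 0 0 0 0] by simp
  have "dir_deriv (jet 0 1 ux utx uxx 0 0 0 0) U ?p =
      P ?p * dir_deriv (jet 0 1 ux utx uxx 0 0 0 0) T ?p +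
      Q ?p * dir_deriv (jet 0 1 ux utx uxx 0 0 0 0) X ?p"
    by (rule contact(1)[OF assms, of _ 0 1 0 0 0 0]) simp
  then show "Q ?p * dir_deriv e_x X ?p = dir_deriv e_x U ?p + ux * dir_deriv e_u U ?p"
    using assms T_spatial_derivatives X_derivatives
      dir_deriv_base[of U ?p 0 1 ux utx uxx 0 0 0 0] dir_deriv_base[of T ?p 0 1 ux utx uxx 0 0 0 0]
      dir_deriv_base[of X ?p 0 1 ux utx uxx 0 0 0 0] by simp
qed

text \<open>Symmetry of second derivatives, applied to T_x = 0, X_t = 0 and X_u = 0.\<close>

lemma second_derivatives_zero:
  assumes "p \<in> D"
  shows "dir_deriv e_x (dir_deriv e_t T) p = 0" "dir_deriv e_t (dir_deriv e_x X) p = 0"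
    "dir_deriv e_u (dir_deriv e_x X) p = 0"
  using T_spatial_derivatives X_derivatives assms
  by (auto intro!: dir_deriv_swap_zero[OF open_D])

text \<open>This is the total x-derivative of the formula for \<open>Q\<close>, in which the contact
  condition turns the derivative of \<open>Q\<close> into \<open>W\<close> times X_x. The two mixed
  derivatives of \<open>U\<close> are kept apart, so no symmetry is invoked for them.\<close>

lemma second_prolongation:
  assumes p: "jet t x u ut ux utt utx uxx b \<in> D" (is "?p \<in> D")
  shows "W ?p * (dir_deriv e_x X ?p)\<^sup>2 + Q ?p * dir_deriv e_x (dir_deriv e_x X) ?p =
    dir_deriv e_x (dir_deriv e_x U) ?p +
    ux * (dir_deriv e_u (dir_deriv e_x U) ?p + dir_deriv e_x (dir_deriv e_u U) ?p) +
    ux\<^sup>2 * dir_deriv e_u (dir_deriv e_u U) ?p + uxx * dir_deriv e_u U ?p"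
proof -
  let ?v = "jet 0 1 ux utx uxx 0 0 0 0"
  \<comment> \<open>u_x has to be a function of the jet for the product rule to apply to its product
    with U_u.\<close>
  define ux_coord :: "ext_jet2 \<Rightarrow> real" where "ux_coord = (\<lambda>p. snd (fst (snd (fst p))))"
  have ux_deriv: "(ux_coord has_derivative ux_coord) (at ?p)"
    unfolding ux_coord_def using bounded_linear_components(5)
    by (rule bounded_linear_imp_has_derivative)
  then have ux_diff: "ux_coord differentiable (at ?p)" and ux_v: "dir_deriv ?v ux_coord ?p = uxx"
    using dir_deriv_eqI[OF ux_deriv] by (auto simp: ux_coord_def differentiable_def)
  have diff: "f differentiable (at ?p)" if "smooth_on D f" for f :: "ext_jet2 \<Rightarrow> real"
    using that p by (rule smooth_on_imp_differentiable)
  have "Q q * dir_deriv e_x X q = dir_deriv e_x U q + ux_coord q * dir_deriv e_u U q" if "q \<in> D" for q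
    using first_prolongation(2) that unfolding ux_coord_def by (cases q) auto
  then have "dir_deriv ?v (\<lambda>q. Q q * dir_deriv e_x X q) ?p =
      dir_deriv ?v (\<lambda>q. dir_deriv e_x U q + ux_coord q * dir_deriv e_u U q) ?p"
    by (rule dir_deriv_cong[OF open_D p]) (simp_all add: diff)
  moreover have "dir_deriv ?v (\<lambda>q. Q q * dir_deriv e_x X q) ?p =
      Q ?p * dir_deriv ?v (dir_deriv e_x X) ?p + dir_deriv ?v Q ?p * dir_deriv e_x X ?p"
    by (intro dir_deriv_mult diff smooth_dir_deriv smooth_components)
  moreover have "dir_deriv ?v (\<lambda>q. dir_deriv e_x U q + ux_coord q * dir_deriv e_u U q) ?p =
      dir_deriv ?v (dir_deriv e_x U) ?p + dir_deriv ?v (\<lambda>q. ux_coord q * dir_deriv e_u U q) ?p"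
    by (intro dir_deriv_add differentiable_mult ux_diff diff smooth_dir_deriv smooth_components)
  moreover have "dir_deriv ?v (\<lambda>q. ux_coord q * dir_deriv e_u U q) ?p =
      ux_coord ?p * dir_deriv ?v (dir_deriv e_u U) ?p + uxx * dir_deriv e_u U ?p"
    using dir_deriv_mult[OF ux_diff diff, of "dir_deriv e_u U" ?v] by (simp add: ux_v)
  moreover have "dir_deriv ?v Q ?p = S ?p * dir_deriv ?v T ?p + W ?p * dir_deriv ?v X ?p"
    by (rule contact(3)[OF p, of _ 0 1 0 0 0 0]) simp
  moreover have base: "dir_deriv ?v f ?p = dir_deriv e_x f ?p + ux * dir_deriv e_u f ?p"
    if "smooth_on D f" "depends_on_base f" for f
    using dir_deriv_base[OF that p, of 0 1 ux utx uxx 0 0 0 0] by simp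
  moreover have "dir_deriv ?v T ?p = 0" "dir_deriv ?v X ?p = dir_deriv e_x X ?p"
    using base[of T] base[of X] T_spatial_derivatives[OF p] X_derivatives[OF p] by simp_all
  moreover have "dir_deriv ?v (dir_deriv e_x X) ?p = dir_deriv e_x (dir_deriv e_x X) ?p"
    using base[of "dir_deriv e_x X"] second_derivatives_zero(3)[OF p] by simp
  moreover have "ux_coord ?p = ux"
    by (simp add: ux_coord_def)
  moreover note base[of "dir_deriv e_x U"] base[of "dir_deriv e_u U"]
  ultimately show ?thesis
    by (simp add: power2_eq_square algebra_simps)
qed

text \<open>Two points of the equation differing by s in u_xx are compared. \<open>G\<close> and
  \<open>Q\<close> are unchanged, \<open>P\<close> changes by \<epsilon> s U_u / T_t and
  \<open>W\<close> by s U_u / X_x^2, so the transformed equation forces equal denominators.\<close>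

lemma T_t_eq:
  assumes "p \<in> D"
  shows "dir_deriv e_t T p = (dir_deriv e_x X p)\<^sup>2"
proof -
  obtain t x u ut ux utt utx uxx b where p_jet: "p = jet t x u ut ux utt utx uxx b"
    by (metis surj_pair)
  obtain ux utt utx uxx where e: "jet t x u (\<epsilon> * uxx + b * ux) ux utt utx uxx b \<in> D" (is "?e \<in> D")
    by (rule equation_point[OF assms[unfolded p_jet]])
  \<comment> \<open>Raising u_t by \<epsilon> for each unit of u_xx keeps the line on the
    equation.\<close>
  obtain r where r: "r > 0" "\<And>s. \<bar>s\<bar> < r \<Longrightarrow> ?e + s *\<^sub>R (jet 0 0 0 \<epsilon> 0 0 0 1 0) \<in> D"
    using open_along_line[OF open_D e] by blast
  define s where "s = r / 2"
  have "s \<noteq> 0"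
    using r(1) s_def by simp
  have "jet t x u (\<epsilon> * (uxx + s) + b * ux) ux utt utx (uxx + s) b
      = ?e + s *\<^sub>R (jet 0 0 0 \<epsilon> 0 0 0 1 0)"
    by (simp add: algebra_simps)
  also have "\<dots> \<in> D"
    using r(1) unfolding s_def by (intro r(2)) simp
  finally have q: "jet t x u (\<epsilon> * (uxx + s) + b * ux) ux utt utx (uxx + s) b \<in> D" (is "?q \<in> D") .
  have same: "f ?e = f p" "f ?q = f p" if "depends_on_base f" for f
    using that e q assms by (auto intro: depends_on_baseD simp: p_jet)
  have G: "G ?q = G ?e"
    by (rule G_eq[OF q e]) simp_all
  have X_nonzero: "dir_deriv e_x X p \<noteq> 0"
    by (rule X_derivatives[OF assms])
  have "Q ?q * dir_deriv e_x X p = Q ?e * dir_deriv e_x X p"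
    using first_prolongation(2)[OF e] first_prolongation(2)[OF q] by (simp add: same)
  then have Q: "Q ?q = Q ?e"
    using X_nonzero by simp
  have P: "(P ?q - P ?e) * dir_deriv e_t T p = \<epsilon> * (s * dir_deriv e_u U p)"
    using first_prolongation(1)[OF e] first_prolongation(1)[OF q]
    by (simp add: same left_diff_distrib) (simp add: algebra_simps)
  have W: "(W ?q - W ?e) * (dir_deriv e_x X p)\<^sup>2 = s * dir_deriv e_u U p"
    using second_prolongation[OF e] second_prolongation[OF q]
    by (simp add: same Q left_diff_distrib) (simp add: algebra_simps)
  have "P ?q - P ?e = \<epsilon> * (W ?q - W ?e)"
    using transformed_equation[OF e] transformed_equation[OF q]
    by (simp add: Q G right_diff_distrib)
  with P have "(W ?q - W ?e) * dir_deriv e_t T p = s * dir_deriv e_u U p"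
    using eps_nonzero by simp
  then have "(W ?q - W ?e) * dir_deriv e_t T p = (W ?q - W ?e) * (dir_deriv e_x X p)\<^sup>2"
    by (simp only: W)
  moreover have "W ?q - W ?e \<noteq> 0"
    using W \<open>s \<noteq> 0\<close> derivatives_nonzero(2)[OF assms] by auto
  ultimately show ?thesis
    by simp
qed

section \<open>Integration over the connected domain\<close>

lemma constant_if_base_derivatives_zero:
  assumes "smooth_on D f" "depends_on_base f"
    and "\<And>p v. p \<in> D \<Longrightarrow> v \<in> {e_t, e_x, e_u} \<Longrightarrow> dir_deriv v f p = 0"
  shows "\<exists>c. \<forall>p\<in>D. f p = c"
proof -
  have "dir_deriv v f p = 0" if "p \<in> D" for v p
  proof -
    obtain a1 a2 a3 a4 a5 a6 a7 a8 a9 where v: "v = jet a1 a2 a3 a4 a5 a6 a7 a8 a9"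
      by (metis surj_pair)
    show ?thesis
      unfolding v using dir_deriv_base[OF assms(1,2) that, of a1 a2 a3 a4 a5 a6 a7 a8 a9]
        assms(3)[OF that] by simp
  qed
  then have "f p = f q" if "p \<in> D" "q \<in> D" for p q
    using constant_on_connected_if_dir_deriv_zero[OF open_D connected_D assms(1)] that by blast
  then show ?thesis
    by blast
qed

text \<open>Subtracting the linear function with these coefficients leaves a function of zero
  derivative on a connected open set.\<close>

lemma affine_if_base_derivatives_constant:
  assumes f: "smooth_on D f" "depends_on_base f"
    and "\<And>p. p \<in> D \<Longrightarrow> dir_deriv e_t f p = a1"
    and "\<And>p. p \<in> D \<Longrightarrow> dir_deriv e_x f p = a2"
    and "\<And>p. p \<in> D \<Longrightarrow> dir_deriv e_u f p = a3"
  shows "\<exists>c. \<forall>t x u ut ux utt utx uxx b. jet t x u ut ux utt utx uxx b \<in> D \<longrightarrow>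
    f (jet t x u ut ux utt utx uxx b) = a1 * t + a2 * x + a3 * u + c"
proof -
  define l :: "ext_jet2 \<Rightarrow> real" where
    "l p = a1 * fst (fst (fst p)) + a2 * fst (snd (fst (fst p))) + a3 * snd (snd (fst (fst p)))" for p
  have l: "bounded_linear l"
    unfolding l_def
    by (intro bounded_linear_add bounded_linear_const_mult bounded_linear_components)
  have "((\<lambda>p. f p - l p) has_derivative (\<lambda>v. 0)) (at p)" if p: "p \<in> D" for p
  proof -
    have "dir_deriv v f p = l v" for v
    proof -
      obtain b1 b2 b3 b4 b5 b6 b7 b8 b9 where v: "v = jet b1 b2 b3 b4 b5 b6 b7 b8 b9"
        by (metis surj_pair)
      show ?thesis
        unfolding v l_def using dir_deriv_base[OF f p, of b1 b2 b3 b4 b5 b6 b7 b8 b9]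
          assms(3-5)[OF p] by simp
    qed
    then have "(f has_derivative l) (at p)"
      using has_derivative_dir_deriv[OF smooth_on_imp_differentiable[OF f(1) p]] by simp
    from has_derivative_diff[OF this bounded_linear_imp_has_derivative[OF l]] show ?thesis
      by simp
  qed
  then have const: "f p - l p = f q - l q" if "p \<in> D" "q \<in> D" for p q
    using has_derivative_zero_unique_connected[OF open_D connected_D, of "\<lambda>p. f p - l p"] that by blast
  show ?thesis
  proof (cases "D = {}")
    case False
    then obtain q where q: "q \<in> D"
      by blast
    have "f (jet t x u ut ux utt utx uxx b) = a1 * t + a2 * x + a3 * u + (f q - l q)"
      if "jet t x u ut ux utt utx uxx b \<in> D" for t x u ut ux utt utx uxx b
      using const[OF that q] by (simp add: l_def)
    then show ?thesis
      by blast
  qed simp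
qed

text \<open>Since T_x = 0, T_t has no x-derivative; differentiating T_t = X_x^2 gives X_x X_xx = 0,
  hence X_xx = 0. The t- and u-derivatives of X_x vanish as well.\<close>

lemma X_x_constant: "\<exists>c. c \<noteq> 0 \<and> (\<forall>p\<in>D. dir_deriv e_x X p = c \<and> dir_deriv e_t T p = c\<^sup>2)"
proof -
  have xx: "dir_deriv e_x (dir_deriv e_x X) p = 0" if p: "p \<in> D" for p
  proof -
    have "dir_deriv e_x (dir_deriv e_t T) p = dir_deriv e_x (\<lambda>q. dir_deriv e_x X q * dir_deriv e_x X q) p"
      by (rule dir_deriv_cong[OF open_D p]) (use p T_t_eq in \<open>simp_all add: power2_eq_square\<close>)
    also have "\<dots> = dir_deriv e_x X p * dir_deriv e_x (dir_deriv e_x X) p +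
        dir_deriv e_x (dir_deriv e_x X) p * dir_deriv e_x X p"
      by (rule dir_deriv_mult) (use p in simp_all)
    finally show ?thesis
      using second_derivatives_zero(1)[OF p] X_derivatives(1)[OF p] by simp
  qed
  have "\<exists>c. \<forall>p\<in>D. dir_deriv e_x X p = c"
    by (rule constant_if_base_derivatives_zero) (use xx second_derivatives_zero in auto)
  then obtain c where c: "\<forall>p\<in>D. dir_deriv e_x X p = c"
    by blast
  moreover have "D \<noteq> {}"
    using in_group unfolding equivalence_group_def admissible_domain_def by blast
  ultimately have "c \<noteq> 0"
    using X_derivatives(1) by blast
  then show ?thesis
    using c T_t_eq by auto
qed

text \<open>Multiplying the transformed equation by \<open>c\<^sup>2\<close> and inserting the
  prolongation formulas gives a quadratic polynomial in u_x; its coefficients are split off.\<close>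

lemma determining_equations:
  assumes c: "c \<noteq> 0" "\<And>p. p \<in> D \<Longrightarrow> dir_deriv e_x X p = c" "\<And>p. p \<in> D \<Longrightarrow> dir_deriv e_t T p = c\<^sup>2"
    and p: "p \<in> D"
  shows "dir_deriv e_t U p - \<epsilon> * dir_deriv e_x (dir_deriv e_x U) p - c * G p * dir_deriv e_x U p = 0"
    "snd p * dir_deriv e_u U p -
      \<epsilon> * (dir_deriv e_u (dir_deriv e_x U) p + dir_deriv e_x (dir_deriv e_u U) p) -
      c * G p * dir_deriv e_u U p = 0"
    "dir_deriv e_u (dir_deriv e_u U) p = 0"
proof -
  obtain t x u ut ux utt utx uxx b where p_jet: "p = jet t x u ut ux utt utx uxx b"
    by (metis surj_pair)
  obtain ux utt utx uxx where e: "jet t x u (\<epsilon> * uxx + b * ux) ux utt utx uxx b \<in> D" (is "?e \<in> D")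
    by (rule equation_point[OF p[unfolded p_jet]])
  obtain r where r: "r > 0" "\<And>s. \<bar>s\<bar> < r \<Longrightarrow> ?e + s *\<^sub>R (jet 0 0 0 b 1 0 0 0 0) \<in> D"
    using open_along_line[OF open_D e] by blast
  have xx: "dir_deriv e_x (dir_deriv e_x X) q = 0" if q: "q \<in> D" for q
    using dir_deriv_cong[OF open_D q c(2), where v = e_x] q by simp
  \<comment> \<open>The coefficients involve only the base point and b, hence do not depend on
    \<open>s\<close>. The terms with u_xx cancel because T_t = X_x^2.\<close>
  have poly: "(dir_deriv e_t U p - \<epsilon> * dir_deriv e_x (dir_deriv e_x U) p - c * G p * dir_deriv e_x U p) +
      (b * dir_deriv e_u U p -
      \<epsilon> * (dir_deriv e_u (dir_deriv e_x U) p + dir_deriv e_x (dir_deriv e_u U) p) -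
      c * G p * dir_deriv e_u U p) * (ux + s) +
      (- \<epsilon> * dir_deriv e_u (dir_deriv e_u U) p) * (ux + s)\<^sup>2 = 0" if s: "\<bar>s\<bar> < r" for s
  proof -
    let ?q = "jet t x u (\<epsilon> * uxx + b * (ux + s)) (ux + s) utt utx uxx b"
    have "?q = ?e + s *\<^sub>R (jet 0 0 0 b 1 0 0 0 0)"
      by (simp add: algebra_simps)
    also have "\<dots> \<in> D"
      using r(2)[OF s] .
    finally have q: "?q \<in> D" .
    have same: "f ?q = f p" if "depends_on_base f" for f
      using that q p by (auto intro: depends_on_baseD simp: p_jet)
    have G: "G ?q = G p"
      by (rule G_eq[OF q p]) (simp_all add: p_jet)
    have P: "P ?q * c\<^sup>2 = dir_deriv e_t U p + (\<epsilon> * uxx + b * (ux + s)) * dir_deriv e_u U p"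
      and Q: "Q ?q * c = dir_deriv e_x U p + (ux + s) * dir_deriv e_u U p"
      using first_prolongation[OF q] p by (simp_all add: same c(2,3))
    have W: "W ?q * c\<^sup>2 = dir_deriv e_x (dir_deriv e_x U) p +
        (ux + s) * (dir_deriv e_u (dir_deriv e_x U) p + dir_deriv e_x (dir_deriv e_u U) p) +
        (ux + s)\<^sup>2 * dir_deriv e_u (dir_deriv e_u U) p + uxx * dir_deriv e_u U p"
      using second_prolongation[OF q] p xx[OF p] by (simp add: same c(2))
    have "P ?q * c\<^sup>2 = (\<epsilon> * W ?q + G p * Q ?q) * c\<^sup>2"
      using transformed_equation[OF q] by (simp only: G)
    also have "\<dots> = \<epsilon> * (W ?q * c\<^sup>2) + c * G p * (Q ?q * c)"
      by (simp add: power2_eq_square ring_distribs)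
    finally have "dir_deriv e_t U p + (\<epsilon> * uxx + b * (ux + s)) * dir_deriv e_u U p = \<epsilon> * (dir_deriv e_x (dir_deriv e_x U) p +
        (ux + s) * (dir_deriv e_u (dir_deriv e_x U) p + dir_deriv e_x (dir_deriv e_u U) p) +
        (ux + s)\<^sup>2 * dir_deriv e_u (dir_deriv e_u U) p + uxx * dir_deriv e_u U p) +
        c * G p * (dir_deriv e_x U p + (ux + s) * dir_deriv e_u U p)"
      by (simp only: P Q W)
    then show ?thesis
      by (simp add: algebra_simps)
  qed
  note coeffs = quadratic_zero_coeffs[OF r(1) poly]
  show "dir_deriv e_t U p - \<epsilon> * dir_deriv e_x (dir_deriv e_x U) p - c * G p * dir_deriv e_x U p = 0"
    by (rule coeffs(1))
  show "snd p * dir_deriv e_u U p -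
      \<epsilon> * (dir_deriv e_u (dir_deriv e_x U) p + dir_deriv e_x (dir_deriv e_u U) p) -
      c * G p * dir_deriv e_u U p = 0"
    using coeffs(2) unfolding p_jet snd_conv .
  show "dir_deriv e_u (dir_deriv e_u U) p = 0"
    using coeffs(3) eps_nonzero by simp
qed

text \<open>Only b is varied. The difference of the second determining equations gives that b
  changes by \<open>c\<close> times the change of \<open>G\<close>, as U_u is nonzero; the
  difference of the first ones then gives U_x = 0. What remains of the first is U_t = 0.\<close>

lemma U_derivatives:
  assumes p: "p \<in> D"
  shows "dir_deriv e_x U p = 0" "dir_deriv e_t U p = 0"
proof -
  obtain c where c: "c \<noteq> 0" "\<And>p. p \<in> D \<Longrightarrow> dir_deriv e_x X p = c"
      "\<And>p. p \<in> D \<Longrightarrow> dir_deriv e_t T p = c\<^sup>2"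
    using X_x_constant by blast
  have x: "dir_deriv e_x U p = 0" if p: "p \<in> D" for p
  proof -
    obtain r where r: "r > 0" "\<And>s. \<bar>s\<bar> < r \<Longrightarrow> p + s *\<^sub>R e_b \<in> D"
      using open_along_line[OF open_D p] by blast
    define q where "q = p + (r / 2) *\<^sub>R e_b"
    have q: "q \<in> D"
      unfolding q_def using r(1) by (intro r(2)) simp
    have base: "fst (fst q) = fst (fst p)"
      unfolding q_def by (simp add: prod_eq_iff)
    have same: "f q = f p" if "depends_on_base f" for f
      using that q p base by (rule depends_on_baseD)
    have "(snd q - snd p) * dir_deriv e_u U p = c * (G q - G p) * dir_deriv e_u U p"
      using determining_equations(2)[OF c p] determining_equations(2)[OF c q]
      by (simp add: same algebra_simps)
    then have "snd q - snd p = c * (G q - G p)"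
      using derivatives_nonzero(2)[OF p] mult_cancel_right by blast
    moreover have "snd q - snd p = r / 2"
      unfolding q_def by simp
    moreover have "dir_deriv e_t U p - \<epsilon> * dir_deriv e_x (dir_deriv e_x U) p -
        c * G q * dir_deriv e_x U p = 0"
      using determining_equations(1)[OF c q] by (simp only: same depends_on_base_components
          depends_on_base_dir_deriv smooth_components smooth_dir_deriv)
    then have "c * (G q - G p) * dir_deriv e_x U p = 0"
      using determining_equations(1)[OF c p] by algebra
    ultimately have "r / 2 * dir_deriv e_x U p = 0"
      by (simp only:)
    then show ?thesis
      using r(1) by simp
  qed
  show "dir_deriv e_x U p = 0"
    by (rule x[OF p])
  have "dir_deriv e_x (dir_deriv e_x U) p = 0"
    using x p by (auto intro!: dir_deriv_swap_zero[OF open_D])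
  then show "dir_deriv e_t U p = 0"
    using determining_equations(1)[OF c p] x[OF p] by simp
qed

text \<open>The t- and x-derivatives of U_u vanish by symmetry from U_t = U_x = 0, and U_uu = 0 is
  the third determining equation.\<close>

lemma U_u_constant: "\<exists>c. c \<noteq> 0 \<and> (\<forall>p\<in>D. dir_deriv e_u U p = c)"
proof -
  obtain c where c: "c \<noteq> 0" "\<And>p. p \<in> D \<Longrightarrow> dir_deriv e_x X p = c"
      "\<And>p. p \<in> D \<Longrightarrow> dir_deriv e_t T p = c\<^sup>2"
    using X_x_constant by blast
  have "dir_deriv e_t (dir_deriv e_u U) p = 0" "dir_deriv e_x (dir_deriv e_u U) p = 0" if "p \<in> D" for p
    by (rule dir_deriv_swap_zero[OF open_D smooth_components(3) _ that], erule U_derivatives)+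
  then have "dir_deriv v (dir_deriv e_u U) p = 0" if "p \<in> D" "v \<in> {e_t, e_x, e_u}" for v p
    using that determining_equations(3)[OF c] by (elim insertE emptyE) simp_all
  then have "\<exists>c. \<forall>p\<in>D. dir_deriv e_u U p = c"
    by (intro constant_if_base_derivatives_zero) simp_all
  then obtain k where k: "\<forall>p\<in>D. dir_deriv e_u U p = k"
    by blast
  obtain q where "q \<in> D"
    using in_group unfolding equivalence_group_def admissible_domain_def by blast
  then have "k \<noteq> 0"
    using k derivatives_nonzero(2)[of q] by simp
  then show ?thesis
    using k by blast
qed

text \<open>\<open>T, X, U\<close> are integrated, \<open>P\<close> and \<open>Q\<close> come from
  the first prolongation, \<open>R\<close> and \<open>S\<close> from the total t-derivatives of
  \<open>P\<close> and \<open>Q\<close>, \<open>W\<close> from the total x-derivative of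
  \<open>Q\<close>, and \<open>G\<close> from the second determining equation.\<close>

lemma Phi_form:
  "\<exists>c1 c2 c3 c4 c5. c1 * c4 \<noteq> 0 \<and>
     (\<forall>t x u ut ux utt utx uxx b. jet t x u ut ux utt utx uxx b \<in> D \<longrightarrow>
       \<Phi> (jet t x u ut ux utt utx uxx b) =
         jet (c1\<^sup>2 * t + c2) (c1 * x + c3) (c4 * u + c5) (c4 / c1 ^ 2 * ut) (c4 / c1 * ux)
           (c4 / c1 ^ 4 * utt) (c4 / c1 ^ 3 * utx) (c4 / c1 ^ 2 * uxx) (1 / c1 * b))"
proof -
  obtain c1 where c1: "c1 \<noteq> 0" "\<And>p. p \<in> D \<Longrightarrow> dir_deriv e_x X p = c1"
      "\<And>p. p \<in> D \<Longrightarrow> dir_deriv e_t T p = c1\<^sup>2"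
    using X_x_constant by blast
  obtain c4 where c4: "c4 \<noteq> 0" "\<And>p. p \<in> D \<Longrightarrow> dir_deriv e_u U p = c4"
    using U_u_constant by blast
  \<comment> \<open>U_x is zero and U_u constant on \<open>D\<close>, so the mixed derivatives drop
    out and the second determining equation becomes b = \<open>c1\<close> times
    \<open>G\<close>.\<close>
  have second: "dir_deriv e_u (dir_deriv e_x U) p = 0" "dir_deriv e_x (dir_deriv e_u U) p = 0"
    if p: "p \<in> D" for p
    using dir_deriv_cong[OF open_D p U_derivatives(1), where v = e_u] dir_deriv_cong[OF open_D p c4(2), where v = e_x] p
    by simp_all
  have "\<exists>c. \<forall>t x u ut ux utt utx uxx b. jet t x u ut ux utt utx uxx b \<in> D \<longrightarrow>
      T (jet t x u ut ux utt utx uxx b) = c1\<^sup>2 * t + 0 * x + 0 * u + c"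
    by (rule affine_if_base_derivatives_constant) (simp_all add: c1 T_spatial_derivatives)
  then obtain c2 where T: "\<And>t x u ut ux utt utx uxx b. jet t x u ut ux utt utx uxx b \<in> D \<Longrightarrow>
      T (jet t x u ut ux utt utx uxx b) = c1\<^sup>2 * t + c2"
    by auto
  have "\<exists>c. \<forall>t x u ut ux utt utx uxx b. jet t x u ut ux utt utx uxx b \<in> D \<longrightarrow>
      X (jet t x u ut ux utt utx uxx b) = 0 * t + c1 * x + 0 * u + c"
    by (rule affine_if_base_derivatives_constant) (simp_all add: c1 X_derivatives)
  then obtain c3 where X: "\<And>t x u ut ux utt utx uxx b. jet t x u ut ux utt utx uxx b \<in> D \<Longrightarrow>
      X (jet t x u ut ux utt utx uxx b) = c1 * x + c3"
    by auto
  have "\<exists>c. \<forall>t x u ut ux utt utx uxx b. jet t x u ut ux utt utx uxx b \<in> D \<longrightarrow>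
      U (jet t x u ut ux utt utx uxx b) = 0 * t + 0 * x + c4 * u + c"
    by (rule affine_if_base_derivatives_constant) (simp_all add: c4 U_derivatives)
  then obtain c5 where U: "\<And>t x u ut ux utt utx uxx b. jet t x u ut ux utt utx uxx b \<in> D \<Longrightarrow>
      U (jet t x u ut ux utt utx uxx b) = c4 * u + c5"
    by auto
  have P: "P p = c4 / c1\<^sup>2 * fst (fst (snd (fst p)))" and Q: "Q p = c4 / c1 * snd (fst (snd (fst p)))"
    if "p \<in> D" for p
  proof -
    obtain t x u ut ux utt utx uxx b where p_jet: "p = jet t x u ut ux utt utx uxx b"
      by (metis surj_pair)
    show "P p = c4 / c1\<^sup>2 * fst (fst (snd (fst p)))" "Q p = c4 / c1 * snd (fst (snd (fst p)))"
      using first_prolongation[OF that[unfolded p_jet]] that c1(1) unfolding p_jet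
      by (simp_all add: c1(2,3) c4(2) U_derivatives field_simps)
  qed
  \<comment> \<open>On \<open>D\<close> the two components agree with linear maps, which are their
    own derivatives.\<close>
  have dP: "dir_deriv v P p = c4 / c1\<^sup>2 * fst (fst (snd (fst v)))"
    and dQ: "dir_deriv v Q p = c4 / c1 * snd (fst (snd (fst v)))" if p: "p \<in> D" for v p
  proof -
    have "bounded_linear (\<lambda>p::ext_jet2. c4 / c1\<^sup>2 * fst (fst (snd (fst p))))"
      "bounded_linear (\<lambda>p::ext_jet2. c4 / c1 * snd (fst (snd (fst p))))"
      by (intro bounded_linear_const_mult bounded_linear_components)+
    note this[THEN bounded_linear_imp_has_derivative, of "at p", THEN dir_deriv_eqI]
    then show "dir_deriv v P p = c4 / c1\<^sup>2 * fst (fst (snd (fst v)))"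
      "dir_deriv v Q p = c4 / c1 * snd (fst (snd (fst v)))"
      using dir_deriv_cong[OF open_D p P] dir_deriv_cong[OF open_D p Q] p by simp_all
  qed
  have "\<Phi> (jet t x u ut ux utt utx uxx b) =
         jet (c1\<^sup>2 * t + c2) (c1 * x + c3) (c4 * u + c5) (c4 / c1 ^ 2 * ut) (c4 / c1 * ux)
           (c4 / c1 ^ 4 * utt) (c4 / c1 ^ 3 * utx) (c4 / c1 ^ 2 * uxx) (1 / c1 * b)"
    if p: "jet t x u ut ux utt utx uxx b \<in> D" (is "?p \<in> D") for t x u ut ux utt utx uxx b
  proof -
    let ?v = "jet 1 0 ut utt utx 0 0 0 0" and ?w = "jet 0 1 ux utx uxx 0 0 0 0"
    have v: "dir_deriv ?v T ?p = c1\<^sup>2" "dir_deriv ?v X ?p = 0"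
      using dir_deriv_base[of T ?p 1 0 ut utt utx 0 0 0 0] dir_deriv_base[of X ?p 1 0 ut utt utx 0 0 0 0]
        p T_spatial_derivatives X_derivatives c1 by simp_all
    have w: "dir_deriv ?w T ?p = 0" "dir_deriv ?w X ?p = c1"
      using dir_deriv_base[of T ?p 0 1 ux utx uxx 0 0 0 0] dir_deriv_base[of X ?p 0 1 ux utx uxx 0 0 0 0]
        p T_spatial_derivatives X_derivatives c1 by simp_all
    have "c4 / c1\<^sup>2 * utt = R ?p * c1\<^sup>2" "c4 / c1 * utx = S ?p * c1\<^sup>2"
      using contact(2,3)[OF p, of ?v 1 0 0 0 0 0] v by (simp_all add: dP[OF p] dQ[OF p])
    moreover have "c4 / c1 * uxx = W ?p * c1"
      using contact(3)[OF p, of ?w 0 1 0 0 0 0] w by (simp add: dQ[OF p])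
    moreover have "G ?p = 1 / c1 * b"
      using determining_equations(2)[OF c1 p] second[OF p] c1(1) c4
      by (simp add: c4(2)[OF p] field_simps)
    ultimately show ?thesis
      unfolding Phi_eq[of ?p] using c1(1) T[OF p] X[OF p] U[OF p] P[OF p] Q[OF p]
      by (simp add: field_simps eval_nat_numeral)
  qed
  then show ?thesis
    using c1(1) c4(1) by (intro exI[of _ c1] exI[of _ c2] exI[of _ c3] exI[of _ c4] exI[of _ c5]) simp
qed

end

section \<open>The scalings and shifts are equivalence transformations\<close>

lemma affine_diffeomorphism_on:
  fixes L L' :: "'a::euclidean_space \<Rightarrow> 'a"
  assumes L: "bounded_linear L" "bounded_linear L'" "\<And>x. L' (L x) = x" "\<And>x. L (L' x) = x"
    and D: "open D" and f: "\<And>x. x \<in> D \<Longrightarrow> f x = L x + w"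
  shows "diffeomorphism_on D f"
proof -
  define g where "g y = L' y + L' (- w)" for y
  have g: "g y = L' (y - w)" for y
    unfolding g_def using linear_add[OF bounded_linear.linear[OF L(2)], of y "- w"] by simp
  have inj: "inj_on f D"
  proof (rule inj_onI)
    fix x y assume "x \<in> D" "y \<in> D" "f x = f y"
    then have "L x = L y"
      using f by simp
    then show "x = y"
      using L(3) by metis
  qed
  \<comment> \<open>As a preimage under the continuous inverse \<open>g\<close>, the image is
    open.\<close>
  have image: "f ` D = g -` D"
  proof (intro set_eqI iffI)
    fix y assume "y \<in> f ` D"
    then obtain x where "x \<in> D" "y = f x"
      by blast
    then show "y \<in> g -` D"
      using f L(3) by (simp add: g)
  next
    fix y assume "y \<in> g -` D"
    then have "g y \<in> D"
      by simp
    moreover have "f (g y) = y"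
      using f[OF \<open>g y \<in> D\<close>] L(4) by (simp add: g)
    ultimately show "y \<in> f ` D"
      by (metis imageI)
  qed
  have "open (f ` D)"
    unfolding image g_def
    using D by (intro open_vimage continuous_intros linear_continuous_on L)
  moreover have "smooth_on D f"
    by (rule smooth_on_cong[OF D _ smooth_on_affine[OF L(1), of _ w]]) (simp add: f)
  moreover have "g y = the_inv_into D f y" if y: "y \<in> f ` D" for y
  proof -
    obtain x where x: "x \<in> D" "y = f x"
      using y by blast
    have "g y = x"
      using f[OF x(1)] L(3) by (simp add: g x(2))
    then show ?thesis
      using the_inv_into_f_f[OF inj x(1)] by (simp add: x(2))
  qed
  then have "smooth_on (f ` D) (the_inv_into D f)"
    by (rule smooth_on_cong[OF \<open>open (f ` D)\<close>]) (simp_all add: g_def smooth_on_affine[OF L(2)])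
  ultimately show ?thesis
    unfolding diffeomorphism_on_def using D inj by blast
qed

text \<open>Linear part of the second prolongation: a derivative of u taken i times in t and j times
  in x is multiplied by c / a^(2i+j). The factor 1 / a of b balances u_xx against b u_x.\<close>

definition scaling :: "real \<Rightarrow> real \<Rightarrow> ext_jet2 \<Rightarrow> ext_jet2" where
  "scaling a c = (\<lambda>(((t, x, u), (ut, ux), (utt, utx, uxx)), b).
     jet (a\<^sup>2 * t) (a * x) (c * u) (c / a ^ 2 * ut) (c / a * ux)
       (c / a ^ 4 * utt) (c / a ^ 3 * utx) (c / a ^ 2 * uxx) (1 / a * b))"

lemma scaling_jet:
  "scaling a c (jet t x u ut ux utt utx uxx b) =
     jet (a\<^sup>2 * t) (a * x) (c * u) (c / a ^ 2 * ut) (c / a * ux)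
       (c / a ^ 4 * utt) (c / a ^ 3 * utx) (c / a ^ 2 * uxx) (1 / a * b)"
  by (simp add: scaling_def)

lemma bounded_linear_scaling: "bounded_linear (scaling a c)"
proof -
  have "linear (scaling a c)"
  proof (rule linearI)
    fix p q :: ext_jet2 and r :: real
    obtain t x u ut ux utt utx uxx b t' x' u' ut' ux' utt' utx' uxx' b'
      where "p = jet t x u ut ux utt utx uxx b" "q = jet t' x' u' ut' ux' utt' utx' uxx' b'"
      by (metis surj_pair)
    then show "scaling a c (p + q) = scaling a c p + scaling a c q"
      "scaling a c (r *\<^sub>R p) = r *\<^sub>R scaling a c p"
      by (simp_all add: scaling_jet distrib_left)
  qed
  then show ?thesis
    by (simp add: linear_conv_bounded_linear)
qed

lemma scaling_inverse:
  assumes "a \<noteq> 0" "c \<noteq> 0"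
  shows "scaling (1 / a) (1 / c) (scaling a c p) = p" "scaling a c (scaling (1 / a) (1 / c) p) = p"
proof -
  obtain t x u ut ux utt utx uxx b where "p = jet t x u ut ux utt utx uxx b"
    by (metis surj_pair)
  then show "scaling (1 / a) (1 / c) (scaling a c p) = p" "scaling a c (scaling (1 / a) (1 / c) p) = p"
    using assms by (simp_all add: scaling_jet power_divide)
qed

text \<open>Interval and function are pulled back along the inverse of the affine map; this includes
  negative \<open>a\<close>, which reverses the interval.\<close>

lemma arbitrary_element_scaled:
  assumes "arbitrary_element I B" and a: "a \<noteq> 0"
  shows "arbitrary_element ((\<lambda>x. a * x + d) ` I) (\<lambda>y. 1 / a * B (1 / a * y + - d / a))"
    (is "arbitrary_element ?J ?B")
proof -
  have I: "open I" "is_interval I" "smooth_on I B"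
    using assms(1) unfolding arbitrary_element_def by auto
  \<comment> \<open>The preimage form gives openness and is the domain appearing in
    \<open>differentiable_order_affine_comp\<close>.\<close>
  have J: "?J = {y. 1 / a * y + - d / a \<in> I}"
    using a by (force simp: field_simps)
  have "continuous_on UNIV (\<lambda>y. 1 / a * y + - d / a)"
    by (intro continuous_intros)
  then have "open ?J"
    unfolding J using open_vimage[OF I(1)] by (simp add: vimage_def)
  moreover have "is_interval ?J"
    using convex_affinity[of I d a] I(2) is_interval_convex_1 by (simp add: add.commute)
  moreover have "smooth_on ?J ?B"
    unfolding smooth_on_def J
  proof
    fix k
    have "differentiable_order k I B"
      using I(3) unfolding smooth_on_def by blast
    then show "differentiable_order k {y. 1 / a * y + - d / a \<in> I} ?B"
      by (intro differentiable_order_bounded_linear_comp[OF bounded_linear_mult_right]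
          differentiable_order_affine_comp[where L = "\<lambda>y. 1 / a * y", OF bounded_linear_mult_right])
  qed
  ultimately show ?thesis
    unfolding arbitrary_element_def by blast
qed

lemma scaling_in_equivalence_group:
  assumes D: "admissible_domain \<epsilon> D" and nz: "c1 \<noteq> 0" "c4 \<noteq> 0"
    and \<Phi>: "\<And>p. p \<in> D \<Longrightarrow> \<Phi> p = scaling c1 c4 p + jet c2 c3 c5 0 0 0 0 0 0"
  shows "(D, \<Phi>) \<in> equivalence_group \<epsilon>"
proof -
  have "open D"
    using D unfolding admissible_domain_def by blast
  have \<Phi>_jet: "\<Phi> (jet t x u ut ux utt utx uxx b) =
      jet (c1\<^sup>2 * t + c2) (c1 * x + c3) (c4 * u + c5) (c4 / c1 ^ 2 * ut) (c4 / c1 * ux)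
        (c4 / c1 ^ 4 * utt) (c4 / c1 ^ 3 * utx) (c4 / c1 ^ 2 * uxx) (1 / c1 * b)"
    if "jet t x u ut ux utt utx uxx b \<in> D" for t x u ut ux utt utx uxx b
    using \<Phi>[OF that] by (simp add: scaling_jet)
  have "diffeomorphism_on D \<Phi>"
    by (rule affine_diffeomorphism_on[OF bounded_linear_scaling bounded_linear_scaling
          scaling_inverse[OF nz] \<open>open D\<close> \<Phi>])
  moreover have "projectable D \<Phi>"
  proof -
    \<comment> \<open>The jet components of a scaling do not see b, so 0 can stand in for it when
      the map on the jet space is written down.\<close>
    have "fst (fst (\<Phi> p)) = (\<lambda>(t, x, u). (c1\<^sup>2 * t + c2, c1 * x + c3, c4 * u + c5)) (fst (fst p))"
      "fst (\<Phi> p) = fst (scaling c1 c4 (fst p, 0) + jet c2 c3 c5 0 0 0 0 0 0)" if "p \<in> D" for p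
    proof -
      obtain t x u ut ux utt utx uxx b where p: "p = jet t x u ut ux utt utx uxx b"
        by (metis surj_pair)
      show "fst (fst (\<Phi> p)) = (\<lambda>(t, x, u). (c1\<^sup>2 * t + c2, c1 * x + c3, c4 * u + c5)) (fst (fst p))"
        "fst (\<Phi> p) = fst (scaling c1 c4 (fst p, 0) + jet c2 c3 c5 0 0 0 0 0 0)"
        using that unfolding p by (simp_all add: \<Phi>_jet scaling_jet)
    qed
    then show ?thesis
      unfolding projectable_def
      by (intro conjI exI[of _ "\<lambda>(t, x, u). (c1\<^sup>2 * t + c2, c1 * x + c3, c4 * u + c5)"]
          exI[of _ "\<lambda>z. fst (scaling c1 c4 (z, 0) + jet c2 c3 c5 0 0 0 0 0 0)"]) blast+
  qed
  moreover have "contact_preserving D \<Phi>"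
    unfolding contact_preserving_def
  proof (intro ballI allI impI)
    fix p v :: ext_jet2 assume p: "p \<in> D" and v: "fst v \<in> contact_space (fst p)"
    have "((\<lambda>p. scaling c1 c4 p + jet c2 c3 c5 0 0 0 0 0 0) has_derivative scaling c1 c4) (at p)"
      by (auto intro!: derivative_eq_intros bounded_linear_imp_has_derivative bounded_linear_scaling)
    then have "(\<Phi> has_derivative scaling c1 c4) (at p)"
      by (rule has_derivative_transform_within_open[OF _ \<open>open D\<close> p]) (simp add: \<Phi>)
    then have deriv: "frechet_derivative \<Phi> (at p) v = scaling c1 c4 v"
      using dir_deriv_eqI unfolding dir_deriv_def by blast
    obtain t x u ut ux utt utx uxx b where p_jet: "p = jet t x u ut ux utt utx uxx b"
      by (metis surj_pair)
    obtain dt dx du dut dux dutt dutx duxx db where v_jet: "v = jet dt dx du dut dux dutt dutx duxx db"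
      by (metis surj_pair)
    \<comment> \<open>Each contact form is pulled back to a constant multiple of the corresponding
      one, with factors \<open>c4\<close>, c4 / c1^2 and c4 / c1.\<close>
    show "fst (frechet_derivative \<Phi> (at p) v) \<in> contact_space (fst (\<Phi> p))"
      using p v nz unfolding deriv unfolding p_jet v_jet fst_conv contact_space_iff
      by (simp add: \<Phi>_jet scaling_jet del: contact_space.simps)
        (simp add: contact_space_iff field_simps eval_nat_numeral del: contact_space.simps)
  qed
  moreover have "\<exists>J B'. arbitrary_element J B' \<and> maps_equation \<epsilon> D \<Phi> I B J B'"
    if B: "arbitrary_element I B" for I B
  proof (intro exI conjI)
    \<comment> \<open>The transformed element is \<open>B\<close> read at the original x, recovered
      from the new coordinate, and divided by \<open>c1\<close>.\<close>
    let ?J = "(\<lambda>x. c1 * x + c3) ` I" and ?B = "\<lambda>y. 1 / c1 * B (1 / c1 * y + - c3 / c1)"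
    show "arbitrary_element ?J ?B"
      by (rule arbitrary_element_scaled[OF B nz(1)])
    define S where "S = jet_domain D I B"
    define F where "F = (\<lambda>z. \<Phi> (z, B (x_coord z)))"
    have arg: "1 / c1 * (c1 * x + c3) + - c3 / c1 = x" for x
      using nz(1) by (simp add: field_simps)
    have pointwise: "x_coord (fst (F z)) \<in> ?J \<and> snd (F z) = ?B (x_coord (fst (F z))) \<and>
        (fst (F z) \<in> kolmogorov_eq \<epsilon> ?J ?B \<longleftrightarrow> z \<in> kolmogorov_eq \<epsilon> I B)" if "z \<in> S" for z
    proof -
      obtain t x u ut ux utt utx uxx where z: "z = ((t, x, u), (ut, ux), (utt, utx, uxx))"
        by (metis surj_pair)
      have x: "x \<in> I" and "jet t x u ut ux utt utx uxx (B x) \<in> D"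
        using that unfolding S_def jet_domain_def z x_coord_def by simp_all
      then have Fz: "F z = jet (c1\<^sup>2 * t + c2) (c1 * x + c3) (c4 * u + c5) (c4 / c1 ^ 2 * ut)
          (c4 / c1 * ux) (c4 / c1 ^ 4 * utt) (c4 / c1 ^ 3 * utx) (c4 / c1 ^ 2 * uxx) (1 / c1 * B x)"
        unfolding F_def z using \<Phi>_jet by (simp add: x_coord_def)
      \<comment> \<open>All terms of the transformed equation carry the nonzero factor c4 / c1^2,
        which can be cancelled.\<close>
      have "c4 / c1 ^ 2 * ut = \<epsilon> * (c4 / c1 ^ 2 * uxx) + 1 / c1 * B x * (c4 / c1 * ux) \<longleftrightarrow>
          c4 / c1 ^ 2 * ut = c4 / c1 ^ 2 * (\<epsilon> * uxx + B x * ux)"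
        by (simp add: power2_eq_square algebra_simps)
      also have "\<dots> \<longleftrightarrow> ut = \<epsilon> * uxx + B x * ux"
        using nz by simp
      finally have eq: "c4 / c1 ^ 2 * ut = \<epsilon> * (c4 / c1 ^ 2 * uxx) + 1 / c1 * B x * (c4 / c1 * ux) \<longleftrightarrow>
          ut = \<epsilon> * uxx + B x * ux" .
      have J: "c1 * x + c3 \<in> ?J"
        using x by blast
      show ?thesis
        unfolding Fz unfolding z x_coord_def fst_conv snd_conv kolmogorov_eq_iff arg eq
        using x J by blast
    qed
    then have "(\<forall>z\<in>S. x_coord (fst (F z)) \<in> ?J \<and> snd (F z) = ?B (x_coord (fst (F z)))) \<and>
        (fst \<circ> F) ` (S \<inter> kolmogorov_eq \<epsilon> I B) = (fst \<circ> F) ` S \<inter> kolmogorov_eq \<epsilon> ?J ?B"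
      by (intro conjI ballI set_eqI) auto
    then show "maps_equation \<epsilon> D \<Phi> I B ?J ?B"
      unfolding maps_equation_def Let_def S_def F_def .
  qed
  ultimately show ?thesis
    using D unfolding equivalence_group_def by blast
qed

theorem proposition29:
  fixes \<epsilon> :: real
  assumes "\<epsilon> \<in> {-1, 1}"
  shows "equivalence_group \<epsilon> =
    {(D, \<Phi>). admissible_domain \<epsilon> D \<and>
       (\<exists>c1 c2 c3 c4 c5 :: real. c1 * c4 \<noteq> 0 \<and>
         (\<forall>t x u ut ux utt utx uxx b.
           (((t, x, u), (ut, ux), (utt, utx, uxx)), b) \<in> D \<longrightarrow>
           \<Phi> (((t, x, u), (ut, ux), (utt, utx, uxx)), b) =
             (((c1\<^sup>2 * t + c2, c1 * x + c3, c4 * u + c5),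
               (c4 / c1 ^ 2 * ut, c4 / c1 * ux),
               (c4 / c1 ^ 4 * utt, c4 / c1 ^ 3 * utx, c4 / c1 ^ 2 * uxx)),
              1 / c1 * b)))}"
    (is "_ = {(D, \<Phi>). admissible_domain \<epsilon> D \<and> ?form D \<Phi>}")
proof (intro set_eqI iffI; clarify)
  fix D \<Phi> assume mem: "(D, \<Phi>) \<in> equivalence_group \<epsilon>"
  interpret equivalence_transformation \<epsilon> D \<Phi>
    using assms mem by unfold_locales auto
  have "admissible_domain \<epsilon> D"
    using mem unfolding equivalence_group_def by blast
  then show "admissible_domain \<epsilon> D \<and> ?form D \<Phi>"
    using Phi_form by blast
next
  fix D :: "ext_jet2 set" and \<Phi> :: "ext_jet2 \<Rightarrow> ext_jet2" and c1 c2 c3 c4 c5 :: real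
  assume D: "admissible_domain \<epsilon> D" and nz: "c1 * c4 \<noteq> 0"
    and \<Phi>: "\<forall>t x u ut ux utt utx uxx b.
           (((t, x, u), (ut, ux), (utt, utx, uxx)), b) \<in> D \<longrightarrow>
           \<Phi> (((t, x, u), (ut, ux), (utt, utx, uxx)), b) =
             (((c1\<^sup>2 * t + c2, c1 * x + c3, c4 * u + c5),
               (c4 / c1 ^ 2 * ut, c4 / c1 * ux),
               (c4 / c1 ^ 4 * utt, c4 / c1 ^ 3 * utx, c4 / c1 ^ 2 * uxx)),
              1 / c1 * b)"
  have "\<Phi> p = scaling c1 c4 p + jet c2 c3 c5 0 0 0 0 0 0" if "p \<in> D" for p
  proof -
    obtain t x u ut ux utt utx uxx b where p: "p = jet t x u ut ux utt utx uxx b"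
      by (metis surj_pair)
    show ?thesis
      using \<Phi>[rule_format, OF that[unfolded p]] unfolding p by (simp add: scaling_jet)
  qed
  then show "(D, \<Phi>) \<in> equivalence_group \<epsilon>"
    using scaling_in_equivalence_group[OF D] nz by auto
qed

end
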